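(* Consider the SINR model on $\mathbb{R}^2$ described in the context. Let $\Phi$ be a stationary, $\nu$-weakly sub-Poisson point process on $\mathbb{R}^2$, let $\Phi_I$ be a point process on $\mathbb{R}^2$ with $\Phi_I\le_{idcx}\Phi_\mu$ for some $\mu>0$, where $\Phi_\mu$ is the homogeneous Poisson point process of intensity $\mu$, and assume also that $l(x)>0$ for all $x\in[0,\infty)$. Then there exist $P,\gamma>0$ such that the SINR graph $G(\Phi,\Phi_I,\gamma)$ (with signal power $P$) percolates.
   Context: Model: parameters $P>0$ (signal power), $N>0$ (environmental noise), $T>0$ (SINR threshold), $\gamma\ge0$, and an attenuation function given by a continuous $l:[0,\infty)\to[0,\infty)$, strictly decreasing on its support, with $l(0)\ge TN/P$, $l\le1$ and $\int_0^\infty x\,l(x)\,dx<\infty$. For a point process $\Phi$ on $\mathbb{R}^2$, the interference at $x$ is $I_\Phi(x)=\sum_{X\in\Phi\setminus\{x\}}l(|X-x|)$, and $$SINR(x,y,\Phi,\gamma)=\frac{P\,l(|x-y|)}{N+\gamma P\,I_{\Phi\setminus\{x\}}(y)}.$$ For point processes $\Phi_B,\Phi_I$ (independence is not assumed), the SINR graph $G(\Phi_B,\Phi_I,\gamma)$ has vertex set $\Phi_B$ and edge set $\{\langle X,Y\rangle\in\Phi_B^2: SINR(Y,X,\Phi_I,\gamma)>T,\ SINR(X,Y,\Phi_I,\gamma)>T\}$. Percolation of the graph means existence of an infinite connected component in the graph-theoretic sense. Point processes are random locally finite counting measures with Radon mean measure. $\Phi$ is $\nu$-weakly sub-Poisson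 if $\mathsf{P}(\Phi(B)=0)\le e^{-\mathsf{E}(\Phi(B))}$ for all Borel sets $B$. A Lebesgue-measurable $f:\mathbb{R}^k\to\mathbb{R}$ is directionally convex ($dcx$) if for all $x,y,p,q\in\mathbb{R}^k$ with $p\le x\le q$, $p\le y\le q$ (coordinatewise) and $x+y=p+q$ one has $f(x)+f(y)\le f(p)+f(q)$; $idcx$ means increasing and $dcx$. $\Phi\le_{idcx}\Phi'$ means that for every $k\ge1$ and all bounded Borel $B_1,\dots,B_k$, $\mathsf{E}f(\Phi(B_1),\dots,\Phi(B_k))\le\mathsf{E}f(\Phi'(B_1),\dots,\Phi'(B_k))$ for all $idcx$ functions $f$ for which both expectations are finite.
   Formalization: The stationary process Φ is additionally assumed to have non-zero intensity; the void process Φ = 0 is stationary and ν-weakly sub-Poisson, but its SINR graph is empty and cannot percolate. *)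

theory Defs
  imports "HOL-Probability.Probability"
begin

text \<open>Configurations are locally finite counting measures, i.e. Borel measures taking
  non-negative integer values on bounded sets; multiple points are allowed. They carry the
  \<open>\<sigma>\<close>-algebra generated by the evaluations at Borel sets.\<close>

definition configurations :: "'b::euclidean_space measure set" where
  "configurations =
     {\<phi>. sets \<phi> = sets borel \<and> (\<forall>B\<in>sets borel. bounded B \<longrightarrow> emeasure \<phi> B \<in> \<nat>)}"

definition config_space :: "'b::euclidean_space measure measure" where
  "config_space = (SUP B\<in>sets borel. vimage_algebra configurations (\<lambda>\<phi>. emeasure \<phi> B) borel)"

definition mean_measure ::
    "'w measure \<Rightarrow> ('w \<Rightarrow> 'b::euclidean_space measure) \<Rightarrow> 'b set \<Rightarrow> ennreal" where
  "mean_measure M \<Phi> B = (\<integral>\<^sup>+\<omega>. emeasure (\<Phi> \<omega>) B \<partial>M)"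

definition point_process ::
    "'w measure \<Rightarrow> ('w \<Rightarrow> 'b::euclidean_space measure) \<Rightarrow> bool" where
  "point_process M \<Phi> \<longleftrightarrow>
     prob_space M \<and> \<Phi> \<in> M \<rightarrow>\<^sub>M config_space \<and>
     (\<forall>B\<in>sets borel. bounded B \<longrightarrow> mean_measure M \<Phi> B < \<infinity>)"

definition points :: "'b::euclidean_space measure \<Rightarrow> 'b set" where
  "points \<phi> = {x. emeasure \<phi> {x} \<noteq> 0}"

definition remove_point :: "'b::euclidean_space \<Rightarrow> 'b measure \<Rightarrow> 'b measure" where
  "remove_point x \<phi> = density \<phi> (indicator (- {x}))"

definition stationary ::
    "'w measure \<Rightarrow> ('w \<Rightarrow> 'b::euclidean_space measure) \<Rightarrow> bool" where
  "stationary M \<Phi> \<longleftrightarrow>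
     (\<forall>a. distr M config_space (\<lambda>\<omega>. distr (\<Phi> \<omega>) borel (\<lambda>x. x + a)) = distr M config_space \<Phi>)"

definition poisson_process ::
    "'w measure \<Rightarrow> ('w \<Rightarrow> 'b::euclidean_space measure) \<Rightarrow> real \<Rightarrow> bool" where
  "poisson_process M \<Phi> \<mu> \<longleftrightarrow>
     point_process M \<Phi> \<and>
     (\<forall>B\<in>sets borel. bounded B \<longrightarrow>
        (\<forall>n::nat. measure M {\<omega> \<in> space M. emeasure (\<Phi> \<omega>) B = of_nat n} =
           exp (- (\<mu> * measure lborel B)) * (\<mu> * measure lborel B) ^ n / fact n)) \<and>
     (\<forall>k (B :: nat \<Rightarrow> 'b set).
        (\<forall>i<k. B i \<in> sets borel \<and> bounded (B i)) \<and> disjoint_family_on B {..<k} \<longrightarrow>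
        prob_space.indep_vars M (\<lambda>_. borel) (\<lambda>i \<omega>. emeasure (\<Phi> \<omega>) (B i)) {..<k})"

definition exp_neg :: "ennreal \<Rightarrow> real" where
  "exp_neg t = (if t = \<infinity> then 0 else exp (- enn2real t))"

definition nu_weakly_sub_poisson ::
    "'w measure \<Rightarrow> ('w \<Rightarrow> 'b::euclidean_space measure) \<Rightarrow> bool" where
  "nu_weakly_sub_poisson M \<Phi> \<longleftrightarrow>
     (\<forall>B\<in>sets borel.
        measure M {\<omega> \<in> space M. emeasure (\<Phi> \<omega>) B = 0} \<le> exp_neg (mean_measure M \<Phi> B))"

text \<open>The dimension \<open>k\<close> is quantified inside the order, so \<open>\<real>\<^sup>k\<close> is
  the set of extensional functions on \<open>{..<k}\<close>.\<close>

abbreviation Rvec :: "nat \<Rightarrow> (nat \<Rightarrow> real) set" where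
  "Rvec k \<equiv> {..<k} \<rightarrow>\<^sub>E UNIV"

definition dcx :: "nat \<Rightarrow> ((nat \<Rightarrow> real) \<Rightarrow> real) \<Rightarrow> bool" where
  "dcx k f \<longleftrightarrow>
     f \<in> borel_measurable (completion (\<Pi>\<^sub>M i\<in>{..<k}. lborel)) \<and>
     (\<forall>x\<in>Rvec k. \<forall>y\<in>Rvec k. \<forall>p\<in>Rvec k. \<forall>q\<in>Rvec k.
        (\<forall>i<k. p i \<le> x i \<and> x i \<le> q i \<and> p i \<le> y i \<and> y i \<le> q i \<and> x i + y i = p i + q i)
        \<longrightarrow> f x + f y \<le> f p + f q)"

definition idcx :: "nat \<Rightarrow> ((nat \<Rightarrow> real) \<Rightarrow> real) \<Rightarrow> bool" where
  "idcx k f \<longleftrightarrow>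
     dcx k f \<and> (\<forall>x\<in>Rvec k. \<forall>y\<in>Rvec k. (\<forall>i<k. x i \<le> y i) \<longrightarrow> f x \<le> f y)"

definition idcx_le ::
    "'w measure \<Rightarrow> ('w \<Rightarrow> 'b::euclidean_space measure) \<Rightarrow>
     'v measure \<Rightarrow> ('v \<Rightarrow> 'b measure) \<Rightarrow> bool" where
  "idcx_le M \<Phi> M' \<Phi>' \<longleftrightarrow>
     (\<forall>k\<ge>1. \<forall>(B :: nat \<Rightarrow> 'b set) f.
        (\<forall>i<k. B i \<in> sets borel \<and> bounded (B i)) \<and> idcx k f \<and>
        integrable M (\<lambda>\<omega>. f (\<lambda>i\<in>{..<k}. measure (\<Phi> \<omega>) (B i))) \<and>
        integrable M' (\<lambda>\<omega>. f (\<lambda>i\<in>{..<k}. measure (\<Phi>' \<omega>) (B i)))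
        \<longrightarrow> (\<integral>\<omega>. f (\<lambda>i\<in>{..<k}. measure (\<Phi> \<omega>) (B i)) \<partial>M)
            \<le> (\<integral>\<omega>. f (\<lambda>i\<in>{..<k}. measure (\<Phi>' \<omega>) (B i)) \<partial>M'))"

text \<open>The condition \<open>l 0 \<ge> T * N / P\<close> involves the signal power and is kept separate.
  Only the values of \<open>l\<close> on \<open>[0, \<infinity>)\<close> matter.\<close>

definition attenuation :: "(real \<Rightarrow> real) \<Rightarrow> bool" where
  "attenuation l \<longleftrightarrow>
     continuous_on {0..} l \<and>
     (\<forall>x\<ge>0. 0 \<le> l x \<and> l x \<le> 1) \<and>
     (\<forall>x y. 0 \<le> x \<and> x < y \<and> l x \<noteq> 0 \<and> l y \<noteq> 0 \<longrightarrow> l y < l x) \<and>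
     set_integrable lborel {0..} (\<lambda>x. x * l x)"

text \<open>As \<open>\<phi>\<close> is a counting measure, the integral is the sum of \<open>l (dist X x)\<close> over the
  points \<open>X \<noteq> x\<close> of \<open>\<phi>\<close>, with multiplicity. It may be infinite, in which case the SINR
  below is 0 (for \<open>\<gamma>, P > 0\<close>).\<close>

definition interference ::
    "(real \<Rightarrow> real) \<Rightarrow> 'b::euclidean_space measure \<Rightarrow> 'b \<Rightarrow> ennreal" where
  "interference l \<phi> x = (\<integral>\<^sup>+X\<in>- {x}. ennreal (l (dist X x)) \<partial>\<phi>)"

definition SINR ::
    "real \<Rightarrow> real \<Rightarrow> (real \<Rightarrow> real) \<Rightarrow> 'b::euclidean_space \<Rightarrow> 'b \<Rightarrow> 'b measure \<Rightarrow> real \<Rightarrow> ennreal"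
  where
  "SINR P N l x y \<phi> \<gamma> =
     ennreal (P * l (dist x y)) /
     (ennreal N + ennreal (\<gamma> * P) * interference l (remove_point x \<phi>) y)"

definition SINR_edges ::
    "real \<Rightarrow> real \<Rightarrow> real \<Rightarrow> (real \<Rightarrow> real) \<Rightarrow>
     'b::euclidean_space measure \<Rightarrow> 'b measure \<Rightarrow> real \<Rightarrow> ('b \<times> 'b) set" where
  "SINR_edges P N T l \<phi>B \<phi>I \<gamma> =
     {(X, Y). X \<in> points \<phi>B \<and> Y \<in> points \<phi>B \<and>
        SINR P N l Y X \<phi>I \<gamma> > ennreal T \<and> SINR P N l X Y \<phi>I \<gamma> > ennreal T}"

definition connected_components :: "'v set \<Rightarrow> ('v \<times> 'v) set \<Rightarrow> 'v set set" where
  "connected_components V E = V // (Restr (E\<^sup>*) V)"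

definition percolates :: "'v set \<Rightarrow> ('v \<times> 'v) set \<Rightarrow> bool" where
  "percolates V E \<longleftrightarrow> (\<exists>C\<in>connected_components V E. infinite C)"

end

(* Cut the plane into square cells. A cell is good if it contains a point of the first process and
   the interference at its points, bounded by a weighted sum of the numbers of points of the second
   process in all cells, stays below a threshold K. Points in neighbouring good cells are joined in
   the SINR graph once P is large and gamma is small. The probability that n given cells are all bad
   is at most p^n with p as small as desired: emptiness is controlled by the void probabilities of a
   union of cells, and large interference by comparing the idcx function (1 + U - a)^+ of a weighted
   count U with the exponential moment of a Poisson process. Such a bound implies percolation of good
   cells by a multi-scale argument: a block of level k + 1 consists of 3 x 3 blocks of level k and is
   bad if two of these are bad, so that the probability of bad blocks decays doubly exponentially;
   good blocks carry clusters that connect to those of neighbouring good blocks, and by Borel-Cantelli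
   the blocks around the origin are eventually good. *)

theory Submission
  imports Defs
begin

section \<open>Coarse graining on the square lattice\<close>

text \<open>The two processes may depend on each other arbitrarily and neither is assumed to have
  independent increments, so distant blocks cannot be decoupled. The substitute is a bound p^n for
  every finite set of n cells, however placed. This form survives the block recursion, because n bad
  blocks of level k + 1 contain 2n distinct bad blocks of level k. Two bad sub-blocks are required
  since a 3 x 3 grid, and its contact with a neighbouring grid, tolerate the loss of one. With at
  most 9 * 9 pairs per block this gives q -> 81 q^2, with unstable fixed point 1/81, whence the
  requirement p <= 1/162. Interference has infinite range, so one point can disturb many cells. What
  helps is that the total attenuation between cells is at most some finite S: the sum of n
  interferences, divided by S, is a weighted count with weights at most 1 and total weight at most
  n, so its Poisson exponential moment is exponential in n only. The choices are made in this order: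
  the cell side s from \<open>\<Phi>\<close>, the threshold K from s and the Poisson bound, then P
  from s, and \<open>\<gamma>\<close> from P and K.\<close>

definition sub_blocks :: "int \<times> int \<Rightarrow> (int \<times> int) set" where
  "sub_blocks z = {u. fst u div 3 = fst z \<and> snd u div 3 = snd z}"

fun bad_block :: "(int \<times> int) set \<Rightarrow> nat \<Rightarrow> int \<times> int \<Rightarrow> bool" where
  "bad_block B 0 z \<longleftrightarrow> z \<in> B"
| "bad_block B (Suc k) z \<longleftrightarrow>
     (\<exists>u\<in>sub_blocks z. \<exists>v\<in>sub_blocks z. u \<noteq> v \<and> bad_block B k u \<and> bad_block B k v)"

text \<open>A bad sub-block is dropped as a whole, even where it contains good sites: only sites
  that are good together with all their ancestors below the top level are kept, so connectivity can
  be lifted level by level.\<close>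

fun cluster :: "(int \<times> int) set \<Rightarrow> nat \<Rightarrow> int \<times> int \<Rightarrow> (int \<times> int) set" where
  "cluster B 0 z = {z}"
| "cluster B (Suc k) z = (\<Union>u\<in>{u \<in> sub_blocks z. \<not> bad_block B k u}. cluster B k u)"

text \<open>Equality is included, so that one statement about adjacent blocks also covers two sites
  of the same block.\<close>

definition lattice_adj :: "int \<times> int \<Rightarrow> int \<times> int \<Rightarrow> bool" where
  "lattice_adj u v \<longleftrightarrow> \<bar>fst u - fst v\<bar> + \<bar>snd u - snd v\<bar> \<le> 1"

definition lattice_edges :: "(int \<times> int \<Rightarrow> bool) \<Rightarrow> ((int \<times> int) \<times> (int \<times> int)) set" where
  "lattice_edges G = {(u, v). G u \<and> G v \<and> lattice_adj u v}"

lemma lattice_adj_sym: "lattice_adj u v \<Longrightarrow> lattice_adj v u"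
  by (simp add: lattice_adj_def abs_minus_commute)

lemma sym_lattice_edges: "sym (lattice_edges G)"
  by (auto simp: sym_def lattice_edges_def dest: lattice_adj_sym)

lemma lattice_edgesI:
  "G u \<Longrightarrow> G v \<Longrightarrow> lattice_adj u v \<Longrightarrow> (u, v) \<in> (lattice_edges G)\<^sup>*"
  by (auto simp: lattice_edges_def)

lemma lattice_path_sym:
  "(u, v) \<in> (lattice_edges G)\<^sup>* \<Longrightarrow> (v, u) \<in> (lattice_edges G)\<^sup>*"
  using sym_rtrancl[OF sym_lattice_edges] by (meson symD)

lemma in_sub_blocks_iff:
  "(a, b) \<in> sub_blocks (x, y) \<longleftrightarrow>
     (a = 3*x \<or> a = 3*x+1 \<or> a = 3*x+2) \<and> (b = 3*y \<or> b = 3*y+1 \<or> b = 3*y+2)"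
  proof -
  have "i div 3 = j \<longleftrightarrow> i = 3*j \<or> i = 3*j+1 \<or> i = 3*j+2" for i j :: int
    by presburger
  then show ?thesis by (simp add: sub_blocks_def)
qed

lemma sub_blocks_eq: "sub_blocks (x, y) = {3*x..3*x+2} \<times> {3*y..3*y+2}"
  by (force simp: in_sub_blocks_iff)

lemma finite_sub_blocks: "finite (sub_blocks z)"
  by (cases z) (simp add: sub_blocks_eq)

lemma card_sub_blocks: "card (sub_blocks z) = 9"
  by (cases z) (simp add: sub_blocks_eq card_cartesian_product)

text \<open>\<open>G\<close> stays abstract because it will be the predicate of being good at an
  arbitrary level.\<close>

definition at_most_one_bad :: "(int \<times> int \<Rightarrow> bool) \<Rightarrow> int \<times> int \<Rightarrow> bool" where
  "at_most_one_bad G z \<longleftrightarrow>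
     (\<forall>u\<in>sub_blocks z. \<forall>v\<in>sub_blocks z. u \<noteq> v \<longrightarrow> G u \<or> G v)"

text \<open>Removing one vertex from the \<open>3 \<times> 3\<close> grid leaves a connected graph: all remaining vertices
  are joined to the centre, or, if the centre is removed, to a corner along the ring.\<close>

lemma grid_connected:
  assumes amo: "at_most_one_bad G z" and "a \<in> sub_blocks z" "b \<in> sub_blocks z" "G a" "G b"
  shows "(a, b) \<in> (lattice_edges G)\<^sup>*"
proof -
  obtain x y where z: "z = (x, y)" by (cases z)
  define g where "g i j = G (3*x+i, 3*y+j)" for i j
  define r where "r i j i' j' \<longleftrightarrow> ((3*x+i, 3*y+j), (3*x+i', 3*y+j')) \<in> (lattice_edges G)\<^sup>*"
    for i j i' j'
  have tr: "r i j i'' j''" if "r i j i' j'" "r i' j' i'' j''" for i j i' j' i'' j''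
    using that unfolding r_def by (rule rtrancl_trans)
  have sy: "r i' j' i j" if "r i j i' j'" for i j i' j'
    using that unfolding r_def by (rule lattice_path_sym)
  have rf: "r i j i j" for i j
    unfolding r_def by simp
  have st: "r i j i' j'" if "g i j" "g i' j'" "\<bar>i - i'\<bar> + \<bar>j - j'\<bar> \<le> 1" for i j i' j'
    using that unfolding r_def g_def by (intro lattice_edgesI) (auto simp: lattice_adj_def)
  have amo': "g i j \<or> g i' j'"
    if "i \<in> {0,1,2}" "j \<in> {0,1,2}" "i' \<in> {0,1,2}" "j' \<in> {0,1,2}" "(i, j) \<noteq> (i', j')" for i j i' j'
  proof -
    have "(3*x+i, 3*y+j) \<in> sub_blocks z" "(3*x+i', 3*y+j') \<in> sub_blocks z"
      using that(1-4) unfolding z in_sub_blocks_iff by auto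
    moreover have "(3*x+i, 3*y+j) \<noteq> (3*x+i', 3*y+j')" using that(5) by simp
    ultimately show ?thesis using amo unfolding at_most_one_bad_def g_def by blast
  qed
  \<comment> \<open>It is enough to find one hub that every good site reaches: the centre, or the
    corner (0, 0) when the centre is bad.\<close>
  have "\<exists>i0 j0. \<forall>i\<in>{0,1,2}. \<forall>j\<in>{0,1,2}. g i j \<longrightarrow> r i j i0 j0"
  proof (cases "g 1 1")
    case True
    have mid: "r 0 1 1 1" if "g 0 1" using that True by (intro st) auto
    have mid2: "r 1 0 1 1" if "g 1 0" using that True by (intro st) auto
    have mid3: "r 2 1 1 1" if "g 2 1" using that True by (intro st) auto
    have mid4: "r 1 2 1 1" if "g 1 2" using that True by (intro st) auto
    \<comment> \<open>The two neighbours of a corner cannot both be bad, and each of them is next to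
      the centre.\<close>
    have c: "g 0 1 \<or> g 1 0" "g 0 1 \<or> g 1 2" "g 2 1 \<or> g 1 0" "g 2 1 \<or> g 1 2"
      by (intro amo'; simp)+
    have "r 0 0 1 1" if "g 0 0"
      using c(1) mid mid2 tr[of 0 0 0 1 1 1] tr[of 0 0 1 0 1 1] st[of 0 0 0 1] st[of 0 0 1 0] that by auto
    moreover have "r 0 2 1 1" if "g 0 2"
      using c(2) mid mid4 tr[of 0 2 0 1 1 1] tr[of 0 2 1 2 1 1] st[of 0 2 0 1] st[of 0 2 1 2] that by auto
    moreover have "r 2 0 1 1" if "g 2 0"
      using c(3) mid3 mid2 tr[of 2 0 2 1 1 1] tr[of 2 0 1 0 1 1] st[of 2 0 2 1] st[of 2 0 1 0] that by auto
    moreover have "r 2 2 1 1" if "g 2 2"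
      using c(4) mid3 mid4 tr[of 2 2 2 1 1 1] tr[of 2 2 1 2 1 1] st[of 2 2 2 1] st[of 2 2 1 2] that by auto
    ultimately show ?thesis
      using mid mid2 mid3 mid4 rf by (intro exI[of _ 1]) auto
  next
    case False
    have g: "g 0 0" "g 0 1" "g 0 2" "g 1 0" "g 1 2" "g 2 0" "g 2 1" "g 2 2"
      using amo'[of 1 1] False by auto
    have 1: "r 0 1 0 0" "r 1 0 0 0" using g by (auto intro: st)
    have 2: "r 0 2 0 0" "r 2 0 0 0"
      using g 1 tr[OF st[of 0 2 0 1]] tr[OF st[of 2 0 1 0]] by auto
    have 3: "r 1 2 0 0" "r 2 1 0 0"
      using g 2 tr[OF st[of 1 2 0 2]] tr[OF st[of 2 1 2 0]] by auto
    have 4: "r 2 2 0 0"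
      using g 3 tr[OF st[of 2 2 1 2]] by auto
    show ?thesis
      using 1 2 3 4 rf False by (intro exI[of _ 0]) auto
  qed
  then obtain i0 j0 where c: "\<And>i j. i \<in> {0,1,2} \<Longrightarrow> j \<in> {0,1,2} \<Longrightarrow> g i j \<Longrightarrow> r i j i0 j0"
    by blast
  have to_c: "(u, (3*x+i0, 3*y+j0)) \<in> (lattice_edges G)\<^sup>*" if "u \<in> sub_blocks z" "G u" for u
  proof -
    obtain i j where u: "u = (3*x+i, 3*y+j)" "i \<in> {0,1,2}" "j \<in> {0,1,2}"
    proof (rule that)
      show "u = (3*x + (fst u - 3*x), 3*y + (snd u - 3*y))" by simp
    qed (use \<open>u \<in> sub_blocks z\<close> in \<open>cases u; auto simp: z in_sub_blocks_iff\<close>)+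
    then show ?thesis using c[of i j] that(2) unfolding r_def g_def by auto
  qed
  show ?thesis
    using rtrancl_trans[OF to_c[OF assms(2,4)] lattice_path_sym[OF to_c[OF assms(3,5)]]] .
qed

text \<open>Along the common side three disjoint pairs of adjacent sub-blocks face each other. Each
  of the two grids spoils at most one pair, so at least one pair is good on both sides.\<close>

lemma facing_pair:
  assumes "at_most_one_bad G z" "at_most_one_bad G z'"
    and "z' = (fst z + 1, snd z) \<or> z' = (fst z, snd z + 1)"
  shows "\<exists>a\<in>sub_blocks z. \<exists>b\<in>sub_blocks z'. G a \<and> G b \<and> lattice_adj a b"
proof -
  have amoD: "G u \<or> G v"
    if "at_most_one_bad G z" "u \<in> sub_blocks z" "v \<in> sub_blocks z" "u \<noteq> v" for z u v
    using that by (auto simp: at_most_one_bad_def)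
  obtain x y where z: "z = (x, y)" by (cases z)
  from assms(3) show ?thesis
  proof
    assume z': "z' = (fst z + 1, snd z)"
    have p: "(3*x+2, 3*y+j) \<in> sub_blocks z" "(3*x+3, 3*y+j) \<in> sub_blocks z'" if "j \<in> {0,1,2}" for j
      using that unfolding z z' fst_conv snd_conv in_sub_blocks_iff by auto
    have "G (3*x+2, 3*y+i) \<or> G (3*x+2, 3*y+j)" "G (3*x+3, 3*y+i) \<or> G (3*x+3, 3*y+j)"
      if "i \<in> {0,1,2}" "j \<in> {0,1,2}" "i \<noteq> j" for i j
      using amoD[OF assms(1) p(1)[OF that(1)] p(1)[OF that(2)]]
        amoD[OF assms(2) p(2)[OF that(1)] p(2)[OF that(2)]] that(3) by auto
    from this[of 0 1] this[of 0 2] this[of 1 2]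
    have "\<exists>j\<in>{0,1,2}. G (3*x+2, 3*y+j) \<and> G (3*x+3, 3*y+j)" by simp blast
    then obtain j where "j \<in> {0,1,2}" "G (3*x+2, 3*y+j)" "G (3*x+3, 3*y+j)" by blast
    moreover have "lattice_adj (3*x+2, 3*y+j) (3*x+3, 3*y+j)" by (simp add: lattice_adj_def)
    ultimately show ?thesis using p[of j] by blast
  next
    assume z': "z' = (fst z, snd z + 1)"
    have p: "(3*x+j, 3*y+2) \<in> sub_blocks z" "(3*x+j, 3*y+3) \<in> sub_blocks z'" if "j \<in> {0,1,2}" for j
      using that unfolding z z' fst_conv snd_conv in_sub_blocks_iff by auto
    have "G (3*x+i, 3*y+2) \<or> G (3*x+j, 3*y+2)" "G (3*x+i, 3*y+3) \<or> G (3*x+j, 3*y+3)"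
      if "i \<in> {0,1,2}" "j \<in> {0,1,2}" "i \<noteq> j" for i j
      using amoD[OF assms(1) p(1)[OF that(1)] p(1)[OF that(2)]]
        amoD[OF assms(2) p(2)[OF that(1)] p(2)[OF that(2)]] that(3) by auto
    from this[of 0 1] this[of 0 2] this[of 1 2]
    have "\<exists>j\<in>{0,1,2}. G (3*x+j, 3*y+2) \<and> G (3*x+j, 3*y+3)" by simp blast
    then obtain j where "j \<in> {0,1,2}" "G (3*x+j, 3*y+2)" "G (3*x+j, 3*y+3)" by blast
    moreover have "lattice_adj (3*x+j, 3*y+2) (3*x+j, 3*y+3)" by (simp add: lattice_adj_def)
    ultimately show ?thesis using p[of j] by blast
  qed
qed

lemma two_grids_connected:
  assumes amo: "at_most_one_bad G z" "at_most_one_bad G z'" and adj: "lattice_adj z z'"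
    and ab: "a \<in> sub_blocks z" "b \<in> sub_blocks z'" "G a" "G b"
  shows "(a, b) \<in> (lattice_edges G)\<^sup>*"
proof -
  have *: "(a, b) \<in> (lattice_edges G)\<^sup>*"
    if amo: "at_most_one_bad G z" "at_most_one_bad G z'"
      and succ: "z' = (fst z + 1, snd z) \<or> z' = (fst z, snd z + 1)"
      and ab: "a \<in> sub_blocks z" "b \<in> sub_blocks z'" "G a" "G b" for z z' a b
  proof -
    obtain u v where uv: "u \<in> sub_blocks z" "v \<in> sub_blocks z'" "G u" "G v" "lattice_adj u v"
      using facing_pair[OF amo succ] by blast
    have "(a, u) \<in> (lattice_edges G)\<^sup>*" "(u, v) \<in> (lattice_edges G)\<^sup>*" "(v, b) \<in> (lattice_edges G)\<^sup>*"
      using grid_connected[OF amo(1) ab(1) uv(1) ab(3) uv(3)] lattice_edgesI[of G, OF uv(3,4,5)]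
        grid_connected[OF amo(2) uv(2) ab(2) uv(4) ab(4)] by auto
    then show ?thesis by (meson rtrancl_trans)
  qed
  have "z' = z \<or> z' = (fst z + 1, snd z) \<or> z' = (fst z, snd z + 1)
      \<or> z = (fst z' + 1, snd z') \<or> z = (fst z', snd z' + 1)"
  proof -
    have "(i' = i \<and> j' = j) \<or> (i' = i + 1 \<and> j' = j) \<or> (i' = i \<and> j' = j + 1)
        \<or> (i = i' + 1 \<and> j = j') \<or> (i = i' \<and> j = j' + 1)"
      if "\<bar>i - i'\<bar> + \<bar>j - j'\<bar> \<le> 1" for i j i' j' :: int
      using that by presburger
    from this[of "fst z" "fst z'" "snd z" "snd z'"] show ?thesis
      using adj unfolding lattice_adj_def prod_eq_iff by simp
  qed
  then consider "z' = z" | "z' = (fst z + 1, snd z) \<or> z' = (fst z, snd z + 1)"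
    | "z = (fst z' + 1, snd z') \<or> z = (fst z', snd z' + 1)"
    by blast
  then show ?thesis
  proof cases
    case 1
    then show ?thesis using grid_connected[OF amo(1)] ab by simp
  next
    case 2
    then show ?thesis by (rule *[OF amo _ ab])
  next
    case 3
    show ?thesis by (rule lattice_path_sym, rule *[OF amo(2,1) 3 ab(2,1,4,3)])
  qed
qed

section \<open>Clusters of good blocks and the infinite component\<close>

lemma good_block_Suc:
  "\<not> bad_block B (Suc k) z \<longleftrightarrow> at_most_one_bad (\<lambda>u. \<not> bad_block B k u) z"
  by (auto simp: at_most_one_bad_def)

lemma good_sub_block:
  assumes "\<not> bad_block B (Suc k) z" "u \<in> sub_blocks z" "v \<in> sub_blocks z" "u \<noteq> v"
  shows "\<not> bad_block B k u \<or> \<not> bad_block B k v"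
  using assms by auto

lemma cluster_nonempty: "\<not> bad_block B k z \<Longrightarrow> cluster B k z \<noteq> {}"
proof (induction k arbitrary: z)
  case (Suc k)
  obtain x y where z: "z = (x, y)" by (cases z)
  have "\<not> bad_block B k (3*x, 3*y) \<or> \<not> bad_block B k (3*x+1, 3*y)"
    by (rule good_sub_block[OF Suc.prems]) (auto simp: z in_sub_blocks_iff)
  moreover have "(3*x, 3*y) \<in> sub_blocks z" "(3*x+1, 3*y) \<in> sub_blocks z"
    by (auto simp: z in_sub_blocks_iff)
  ultimately obtain u where u: "u \<in> sub_blocks z" "\<not> bad_block B k u"
    by blast
  then show ?case using Suc.IH[OF u(2)] u unfolding cluster.simps by blast
qed simp

text \<open>Induction on the level. Within two adjacent good blocks, any two good sub-blocks are
  joined by a path of good sub-blocks; every edge of this coarse path is lifted by the induction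
  hypothesis, passing through some site of each intermediate cluster, which is nonempty.\<close>

lemma cluster_connected:
  assumes "\<not> bad_block B k z" "\<not> bad_block B k z'" "lattice_adj z z'"
    and "u \<in> cluster B k z" "v \<in> cluster B k z'"
  shows "(u, v) \<in> (lattice_edges (\<lambda>u. u \<notin> B))\<^sup>*"
  using assms
proof (induction k arbitrary: z z' u v)
  case 0
  then show ?case by (auto intro!: lattice_edgesI)
next
  case (Suc k)
  let ?G = "\<lambda>u. \<not> bad_block B k u"
  obtain a where a: "a \<in> sub_blocks z" "?G a" "u \<in> cluster B k a" using Suc.prems by auto
  obtain b where b: "b \<in> sub_blocks z'" "?G b" "v \<in> cluster B k b" using Suc.prems by auto
  have "(a, b) \<in> (lattice_edges ?G)\<^sup>*"
    using two_grids_connected[of ?G z z' a b] Suc.prems a b by (simp add: good_block_Suc[symmetric])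
  then have "\<forall>v\<in>cluster B k b. (u, v) \<in> (lattice_edges (\<lambda>u. u \<notin> B))\<^sup>*"
  proof (induction rule: rtrancl_induct)
    case base
    then show ?case using Suc.IH[of a a u] a by (auto simp: lattice_adj_def)
  next
    case (step c d)
    then have cd: "?G c" "?G d" "lattice_adj c d" by (auto simp: lattice_edges_def)
    obtain w where w: "w \<in> cluster B k c" using cluster_nonempty[OF cd(1)] by auto
    show ?case
      using Suc.IH[OF cd w] step.IH w by (meson rtrancl_trans)
  qed
  then show ?case using b by auto
qed

text \<open>Locates clusters in the plane, which is how the component will be seen to leave every
  bounded set.\<close>

lemma cluster_fst: "u \<in> cluster B k z \<Longrightarrow> fst u div 3 ^ k = fst z"
proof (induction k arbitrary: z)
  case (Suc k)
  then obtain a where a: "a \<in> sub_blocks z" "u \<in> cluster B k a" by auto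
  have "fst u div 3 ^ Suc k = fst u div 3 ^ k div 3"
    by (simp add: power_Suc2 zdiv_zmult2_eq del: power_Suc)
  then show ?case using Suc.IH[OF a(2)] a(1) by (simp add: sub_blocks_def)
qed simp

lemma cluster_good: "u \<in> cluster B k z \<Longrightarrow> \<not> bad_block B k z \<Longrightarrow> u \<notin> B"
proof (induction k arbitrary: z)
  case (Suc k)
  from Suc.prems(1) obtain a where "\<not> bad_block B k a" "u \<in> cluster B k a" by auto
  then show ?case by (rule Suc.IH[rotated])
qed simp

text \<open>The origin block of each level is a sub-block of the next one. A site of its cluster at
  level \<open>K\<close> therefore stays in the cluster at all higher levels, where it is connected
  to sites further and further away.\<close>

lemma infinite_component:
  assumes ev: "\<forall>k\<ge>K. \<not> bad_block B k (0, 0)"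
  shows "\<exists>u. u \<notin> B \<and> infinite {v. (u, v) \<in> (lattice_edges (\<lambda>u. u \<notin> B))\<^sup>*}"
proof -
  let ?R = "lattice_edges (\<lambda>u. u \<notin> B)"
  obtain u where u: "u \<in> cluster B K (0, 0)"
    using cluster_nonempty ev by blast
  have u_in: "u \<in> cluster B k (0, 0)" if "k \<ge> K" for k
    using that
  proof (induction k rule: dec_induct)
    case (step k)
    have "(0, 0) \<in> sub_blocks (0, 0)" by (simp add: sub_blocks_def)
    then show ?case using ev step by (auto simp del: bad_block.simps)
  qed (rule u)
  have far: "\<exists>v. (u, v) \<in> ?R\<^sup>* \<and> fst v \<ge> 3 ^ k" if "k \<ge> K" for k
  proof -
    have g: "\<not> bad_block B (Suc k) (0, 0)" using ev that le_SucI by blast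
    \<comment> \<open>Both are sub-blocks of the origin block and lie at first coordinate at least
      3^k; being two, they cannot both be bad.\<close>
    have "\<not> bad_block B k (1, 0) \<or> \<not> bad_block B k (2, 0)"
      by (rule good_sub_block[OF g]) (auto simp: sub_blocks_def)
    moreover have "(1, 0) \<in> sub_blocks (0, 0)" "(2, 0) \<in> sub_blocks (0, 0)"
      by (auto simp: sub_blocks_def)
    ultimately obtain a where a: "a \<in> sub_blocks (0, 0)" "\<not> bad_block B k a" "fst a \<ge> 1"
      by fastforce
    obtain v where v: "v \<in> cluster B k a" using cluster_nonempty[OF a(2)] by auto
    have "v \<in> cluster B (Suc k) (0, 0)" using a v unfolding cluster.simps by blast
    then have "(u, v) \<in> ?R\<^sup>*"
      using cluster_connected[OF g g] u_in[of "Suc k"] that by (auto simp: lattice_adj_def)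
    moreover have "fst v div 3 ^ k \<ge> 1" using cluster_fst[OF v] a by simp
    then have "fst v \<ge> 3 ^ k"
      by (simp add: pos_imp_zdiv_pos_iff int_one_le_iff_zero_less)
    ultimately show ?thesis by blast
  qed
  have "infinite {v. (u, v) \<in> ?R\<^sup>*}"
  proof
    assume "finite {v. (u, v) \<in> ?R\<^sup>*}"
    then have fin: "finite (fst ` {v. (u, v) \<in> ?R\<^sup>*})" by simp
    obtain m where m: "\<And>v. (u, v) \<in> ?R\<^sup>* \<Longrightarrow> fst v \<le> m"
      using bdd_above_finite[OF fin] by (auto simp: bdd_above_def image_iff) blast
    obtain v where v: "(u, v) \<in> ?R\<^sup>*" "fst v \<ge> 3 ^ (K + nat m)"
      using far[of "K + nat m"] by auto
    have "m < 3 ^ (K + nat m)"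
    proof -
      have "K + nat m < 3 ^ (K + nat m)" by (rule power_gt_expt) simp
      then have "int (K + nat m) < int (3 ^ (K + nat m))" by (simp only: of_nat_less_iff)
      moreover have "m \<le> int (K + nat m)" by simp
      ultimately show ?thesis by (simp del: int_nat_eq)
    qed
    then show False using m[OF v(1)] v(2) by simp
  qed
  then show ?thesis using u cluster_good ev by blast
qed

section \<open>Doubly exponential decay of the probability of bad blocks\<close>

context prob_space
begin

lemma events_bad_block:
  assumes "\<And>z. {\<omega> \<in> space M. z \<in> B \<omega>} \<in> events"
  shows "{\<omega> \<in> space M. bad_block (B \<omega>) k z} \<in> events"
proof (induction k arbitrary: z)
  case (Suc k)
  have "{\<omega> \<in> space M. bad_block (B \<omega>) (Suc k) z} = (\<Union>u\<in>sub_blocks z. \<Union>v\<in>sub_blocks z - {u}.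
      {\<omega> \<in> space M. bad_block (B \<omega>) k u} \<inter> {\<omega> \<in> space M. bad_block (B \<omega>) k v})"
    by (rule set_eqI, simp, blast)
  also have "\<dots> \<in> events"
    using Suc.IH by (intro sets.finite_UN finite_sub_blocks finite_Diff sets.Int)
  finally show ?case .
qed (use assms in simp)

text \<open>Union bound over the choice of a pair of bad sub-blocks in each block of
  \<open>Z\<close>: at most 81^n choices for n blocks, each forcing 2n distinct blocks of the lower
  level to be bad. Hence the bound q per block becomes 81 q^2, and the stated expression solves this
  recursion. The induction needs all finite \<open>Z\<close>, even when only a single block is of
  interest.\<close>

lemma prob_bad_blocks_le:
  assumes ev: "\<And>z. {\<omega> \<in> space M. z \<in> B \<omega>} \<in> events"
    and p: "\<And>Z. finite Z \<Longrightarrow> prob {\<omega> \<in> space M. Z \<subseteq> B \<omega>} \<le> p ^ card Z" and "0 \<le> p"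
    and "finite Z"
  shows "prob {\<omega> \<in> space M. \<forall>z\<in>Z. bad_block (B \<omega>) k z} \<le> ((81 * p) ^ (2 ^ k) / 81) ^ card Z"
  using \<open>finite Z\<close>
proof (induction k arbitrary: Z)
  case 0
  then show ?case using p[of Z] by (simp add: subset_eq)
next
  case (Suc k)
  define q where "q = (81 * p) ^ (2 ^ k) / 81"
  have q0: "0 \<le> q" using \<open>0 \<le> p\<close> by (simp add: q_def)
  define D where "D z = {uv \<in> sub_blocks z \<times> sub_blocks z. fst uv \<noteq> snd uv}" for z
  have finD: "finite (D z)" for z unfolding D_def using finite_sub_blocks by auto
  have cardD: "card (D z) \<le> 81" for z
  proof -
    have "card (D z) \<le> card (sub_blocks z \<times> sub_blocks z)"
      unfolding D_def by (intro card_mono) (auto simp: finite_sub_blocks)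
    then show ?thesis by (simp add: card_cartesian_product card_sub_blocks)
  qed
  \<comment> \<open>The selected lower-level blocks. A sub-block determines its parent and the two
    members of a pair differ, so no two selections coincide.\<close>
  define W where "W f = (fst \<circ> f) ` Z \<union> (snd \<circ> f) ` Z" for f :: "int \<times> int \<Rightarrow> (int \<times> int) \<times> (int \<times> int)"
  let ?F = "PiE Z D"
  have finF: "finite ?F" using Suc.prems finD by (intro finite_PiE) auto
  have cardW: "finite (W f)" "card (W f) = 2 * card Z" if f: "f \<in> ?F" for f
  proof -
    have fD: "fst (f z) \<in> sub_blocks z" "snd (f z) \<in> sub_blocks z" "fst (f z) \<noteq> snd (f z)"
      if "z \<in> Z" for z
      using PiE_mem[OF f that] by (auto simp: D_def)
    have same: "z = z'" if "u \<in> sub_blocks z" "u \<in> sub_blocks z'" for u z z'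
      using that by (auto simp: sub_blocks_def prod_eq_iff)
    have "z = z'" if "z \<in> Z" "z' \<in> Z" "fst (f z) = fst (f z') \<or> snd (f z) = snd (f z')" for z z'
      using that(3) fD(1,2)[OF that(1)] fD(1,2)[OF that(2)]
        same[of "fst (f z)" z z'] same[of "snd (f z)" z z'] by auto
    then have "inj_on (fst \<circ> f) Z" "inj_on (snd \<circ> f) Z"
      unfolding inj_on_def comp_apply by blast+
    moreover have "(fst \<circ> f) ` Z \<inter> (snd \<circ> f) ` Z = {}"
    proof -
      have False if "z \<in> Z" "z' \<in> Z" "fst (f z) = snd (f z')" for z z'
        using fD[OF that(1)] fD[OF that(2)] that(3) same[of "fst (f z)" z z'] by auto
      then show ?thesis by fastforce
    qed
    ultimately show "card (W f) = 2 * card Z"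
      using Suc.prems unfolding W_def by (simp add: card_Un_disjoint card_image del: comp_apply)
    show "finite (W f)" using Suc.prems by (simp add: W_def)
  qed
  have evb: "{\<omega> \<in> space M. \<forall>w\<in>W f. bad_block (B \<omega>) k w} \<in> events" if "f \<in> ?F" for f
    using cardW(1)[OF that] by (intro sets.sets_Collect_finite_All events_bad_block ev)
  have sub: "{\<omega> \<in> space M. \<forall>z\<in>Z. bad_block (B \<omega>) (Suc k) z}
      \<subseteq> (\<Union>f\<in>?F. {\<omega> \<in> space M. \<forall>w\<in>W f. bad_block (B \<omega>) k w})"
  proof
    fix \<omega> assume "\<omega> \<in> {\<omega> \<in> space M. \<forall>z\<in>Z. bad_block (B \<omega>) (Suc k) z}"
    then have \<omega>: "\<omega> \<in> space M" and bad: "\<And>z. z \<in> Z \<Longrightarrow> bad_block (B \<omega>) (Suc k) z"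
      by (blast, blast)
    have "\<forall>z\<in>Z. \<exists>uv. uv \<in> D z \<and> bad_block (B \<omega>) k (fst uv) \<and> bad_block (B \<omega>) k (snd uv)"
    proof
      fix z assume "z \<in> Z"
      from bad[OF this] obtain u v where uv: "u \<in> sub_blocks z" "v \<in> sub_blocks z" "u \<noteq> v"
        "bad_block (B \<omega>) k u" "bad_block (B \<omega>) k v"
        unfolding bad_block.simps by blast
      then show "\<exists>uv. uv \<in> D z \<and> bad_block (B \<omega>) k (fst uv) \<and> bad_block (B \<omega>) k (snd uv)"
        by (intro exI[of _ "(u, v)"]) (simp add: D_def)
    qed
    from bchoice[OF this] obtain g where g: "\<forall>z\<in>Z. g z \<in> D z \<and>
        bad_block (B \<omega>) k (fst (g z)) \<and> bad_block (B \<omega>) k (snd (g z))" ..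
    have "restrict g Z \<in> ?F" using g by simp
    moreover have "\<forall>w\<in>W (restrict g Z). bad_block (B \<omega>) k w"
      using g by (simp add: W_def ball_Un)
    ultimately have "restrict g Z \<in> ?F" "\<forall>w\<in>W (restrict g Z). bad_block (B \<omega>) k w"
      by blast+
    then show "\<omega> \<in> (\<Union>f\<in>?F. {\<omega> \<in> space M. \<forall>w\<in>W f. bad_block (B \<omega>) k w})"
      using \<omega> by blast
  qed
  have "prob {\<omega> \<in> space M. \<forall>z\<in>Z. bad_block (B \<omega>) (Suc k) z}
      \<le> prob (\<Union>f\<in>?F. {\<omega> \<in> space M. \<forall>w\<in>W f. bad_block (B \<omega>) k w})"
    using finF evb by (intro finite_measure_mono[OF sub] sets.finite_UN) auto
  also have "\<dots> \<le> (\<Sum>f\<in>?F. prob {\<omega> \<in> space M. \<forall>w\<in>W f. bad_block (B \<omega>) k w})"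
    using evb finF by (intro finite_measure_subadditive_finite) auto
  also have "\<dots> \<le> (\<Sum>f\<in>?F. q ^ (2 * card Z))"
  proof (rule sum_mono)
    fix f assume f: "f \<in> ?F"
    show "prob {\<omega> \<in> space M. \<forall>w\<in>W f. bad_block (B \<omega>) k w} \<le> q ^ (2 * card Z)"
      using Suc.IH[OF cardW(1)[OF f], folded q_def] unfolding cardW(2)[OF f] .
  qed
  also have "\<dots> = real (card ?F) * (q\<^sup>2) ^ card Z"
    by (simp add: power_mult)
  also have "real (card ?F) \<le> 81 ^ card Z"
  proof -
    have "card ?F \<le> (\<Prod>z\<in>Z. 81)"
      unfolding card_PiE[OF Suc.prems] using cardD by (intro prod_mono) simp
    then have "card ?F \<le> 81 ^ card Z" by simp
    then have "real (card ?F) \<le> real (81 ^ card Z)" by (simp only: of_nat_le_iff)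
    then show ?thesis by simp
  qed
  also have "81 ^ card Z * (q\<^sup>2) ^ card Z = (81 * q\<^sup>2) ^ card Z"
    by (simp add: power_mult_distrib)
  also have "81 * q\<^sup>2 = (81 * p) ^ (2 ^ Suc k) / 81"
    by (simp add: q_def power2_eq_square power_mult_distrib mult_2 power_add flip: power_mult)
  finally show ?case by (simp add: mult_right_mono)
qed

theorem AE_infinite_component:
  assumes ev: "\<And>z. {\<omega> \<in> space M. z \<in> B \<omega>} \<in> events"
    and p: "\<And>Z. finite Z \<Longrightarrow> prob {\<omega> \<in> space M. Z \<subseteq> B \<omega>} \<le> p ^ card Z"
    and "0 \<le> p" "p \<le> 1 / 162"
  shows "AE \<omega> in M. \<exists>u. u \<notin> B \<omega> \<and> infinite {v. (u, v) \<in> (lattice_edges (\<lambda>u. u \<notin> B \<omega>))\<^sup>*}"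
proof -
  define A where "A k = {\<omega> \<in> space M. bad_block (B \<omega>) k (0, 0)}" for k
  have A: "A k \<in> events" for k unfolding A_def by (rule events_bad_block[OF ev])
  have le: "prob (A k) \<le> (1 / 2) ^ k" for k
  proof -
    have "prob (A k) \<le> (81 * p) ^ (2 ^ k) / 81"
      using prob_bad_blocks_le[where Z="{(0, 0)}" and k=k, OF ev p \<open>0 \<le> p\<close>] unfolding A_def by simp
    also have "\<dots> \<le> (81 * p) ^ (2 ^ k) / 1" using \<open>0 \<le> p\<close> by (intro divide_left_mono) auto
    also have "\<dots> \<le> (1 / 2) ^ (2 ^ k)"
      unfolding div_by_1 using assms(3,4) by (intro power_mono) linarith+
    \<comment> \<open>Geometric decay is already summable, which is all that Borel-Cantelli asks
      for.\<close>
    also have "\<dots> \<le> (1 / 2) ^ k"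
    proof (rule power_decreasing)
      show "k \<le> 2 ^ k" by (rule less_imp_le) (rule less_exp)
    qed simp_all
    finally show ?thesis .
  qed
  have "summable (\<lambda>k. prob (A k))"
    using le by (intro summable_comparison_test[OF _ summable_geometric[of "1 / 2"]]) auto
  then have "AE \<omega> in M. eventually (\<lambda>k. \<omega> \<in> space M - A k) sequentially"
    using A by (intro borel_cantelli_AE1) (auto simp: emeasure_eq_measure)
  then show ?thesis
  proof eventually_elim
    case (elim \<omega>)
    then obtain K where "\<forall>k\<ge>K. \<omega> \<in> space M - A k" by (auto simp: eventually_sequentially)
    then have "\<forall>k\<ge>K. \<not> bad_block (B \<omega>) k (0, 0)" by (auto simp: A_def)
    then show ?case by (rule infinite_component)
  qed
qed

end

section \<open>Point configurations and the SINR graph\<close>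

lemma configuration_sets: "\<phi> \<in> configurations \<Longrightarrow> sets \<phi> = sets borel"
  and configuration_Nats:
    "\<phi> \<in> configurations \<Longrightarrow> B \<in> sets borel \<Longrightarrow> bounded B \<Longrightarrow> emeasure \<phi> B \<in> \<nat>"
  unfolding configurations_def by blast+

lemma Nats_ennreal_lt_top: "(x :: ennreal) \<in> \<nat> \<Longrightarrow> x < \<infinity>"
  by (erule Nats_cases) (simp add: of_nat_less_top)

lemma Nats_ennreal_less_1: "(x :: ennreal) \<in> \<nat> \<Longrightarrow> x < 1 \<Longrightarrow> x = 0"
  by (erule Nats_cases) (simp add: ennreal_of_nat_eq_real_of_nat ennreal_less_one_iff)

text \<open>By compactness: around a point of mass 0 the integer-valued measure vanishes on a small
  ball.\<close>

lemma ex_point_of_nonzero_measure: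
  fixes \<phi> :: "'b::euclidean_space measure"
  assumes \<phi>: "\<phi> \<in> configurations" and B: "B \<in> sets borel" "bounded B"
    and nz: "emeasure \<phi> B \<noteq> 0"
  shows "\<exists>x\<in>B. x \<in> points \<phi>"
proof (rule ccontr)
  assume "\<not> ?thesis"
  then have no: "emeasure \<phi> {x} = 0" if "x \<in> B" for x
    using that by (auto simp: points_def)
  have sets: "sets \<phi> = sets borel" by (rule configuration_sets[OF \<phi>])
  have fin: "emeasure \<phi> (B \<inter> A) < \<infinity>" "emeasure \<phi> (B \<inter> A) \<in> \<nat>" if "A \<in> sets borel" for A
  proof -
    show "emeasure \<phi> (B \<inter> A) \<in> \<nat>"
      using B that bounded_Int by (intro configuration_Nats[OF \<phi>]) auto
    then show "emeasure \<phi> (B \<inter> A) < \<infinity>" by (rule Nats_ennreal_lt_top)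
  qed
  \<comment> \<open>Proved for every \<open>x\<close>, also outside \<open>B\<close>: the set to be
    covered by balls is the compact closure of \<open>B\<close>, and for \<open>x\<close> outside
    \<open>B\<close> the intersection \<open>B \<inter> {x}\<close> is empty.\<close>
  have "\<exists>n. emeasure \<phi> (B \<inter> ball x (1 / Suc n)) = 0" for x
  proof -
    have "(\<lambda>n. emeasure \<phi> (B \<inter> ball x (1 / Suc n)))
        \<longlonglongrightarrow> emeasure \<phi> (\<Inter>n. B \<inter> ball x (1 / Suc n))"
    proof (rule Lim_emeasure_decseq)
      show "range (\<lambda>n. B \<inter> ball x (1 / real (Suc n))) \<subseteq> sets \<phi>"
        unfolding sets using B(1) by (intro image_subsetI sets.Int) auto
      show "decseq (\<lambda>n. B \<inter> ball x (1 / real (Suc n)))"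
      proof (rule antimonoI)
        fix m n :: nat assume "m \<le> n"
        then have "1 / real (Suc n) \<le> 1 / real (Suc m)" by (intro divide_left_mono) auto
        then show "B \<inter> ball x (1 / real (Suc n)) \<subseteq> B \<inter> ball x (1 / real (Suc m))"
          using subset_ball by blast
      qed
      show "emeasure \<phi> (B \<inter> ball x (1 / real (Suc n))) \<noteq> \<infinity>" for n
        using fin(1)[of "ball x (1 / real (Suc n))"] by auto
    qed
    also have "(\<Inter>n. B \<inter> ball x (1 / Suc n)) = B \<inter> {x}"
    proof -
      have "y = x" if "\<forall>n. dist x y < 1 / Suc n" for y
      proof (rule ccontr)
        assume "y \<noteq> x"
        then have "dist x y > 0" by simp
        then obtain n where "1 / Suc n < dist x y" by (rule nat_approx_posE)
        then show False using that[rule_format, of n] by simp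
      qed
      moreover have "y \<in> B \<and> (\<forall>n. dist x y < 1 / Suc n)" if "y \<in> (\<Inter>n. B \<inter> ball x (1 / Suc n))" for y
        using that by simp
      ultimately show ?thesis by (intro equalityI subsetI) auto
    qed
    also have "emeasure \<phi> (B \<inter> {x}) = 0"
      using no[of x] by (cases "x \<in> B") auto
    finally have "eventually (\<lambda>n. emeasure \<phi> (B \<inter> ball x (1 / Suc n)) < 1) sequentially"
      by (rule order_tendstoD) simp
    then obtain n where "emeasure \<phi> (B \<inter> ball x (1 / Suc n)) < 1"
      by (auto simp: eventually_sequentially)
    then have "emeasure \<phi> (B \<inter> ball x (1 / Suc n)) = 0"
      by (intro Nats_ennreal_less_1 fin(2)) auto
    then show ?thesis ..
  qed
  then have "\<forall>x. \<exists>n. emeasure \<phi> (B \<inter> ball x (1 / Suc n)) = 0" ..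
  from choice[OF this] obtain r where r: "\<And>x. emeasure \<phi> (B \<inter> ball x (1 / Suc (r x))) = 0"
    by blast
  have "compact (closure B)" using B by simp
  moreover have "closure B \<subseteq> (\<Union>x\<in>closure B. ball x (1 / Suc (r x)))"
    by force
  ultimately obtain D where D: "D \<subseteq> closure B" "finite D"
      "closure B \<subseteq> (\<Union>x\<in>D. ball x (1 / Suc (r x)))"
    by (rule compactE_image[OF _ open_ball])
  let ?U = "\<lambda>x. B \<inter> ball x (1 / Suc (r x))"
  have U: "?U x \<in> sets \<phi>" for x
    unfolding sets using B(1) by (intro sets.Int) auto
  have "B \<subseteq> (\<Union>x\<in>D. ?U x)" using D(3) closure_subset by blast
  then have "emeasure \<phi> B \<le> emeasure \<phi> (\<Union>x\<in>D. ?U x)"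
    using D(2) U by (intro emeasure_mono sets.finite_UN)
  also have "\<dots> \<le> (\<Sum>x\<in>D. emeasure \<phi> (?U x))"
    using D(2) U by (intro emeasure_subadditive_finite image_subsetI)
  also have "\<dots> = 0" using r by simp
  finally show False using nz by simp
qed

subsection \<open>Cells of a square grid\<close>

text \<open>Half-open squares tile the plane without overlap, so that counts and mean measures add
  up exactly.\<close>

definition cell :: "real \<Rightarrow> int \<times> int \<Rightarrow> (real^2) set" where
  "cell s z = {x. of_int (fst z) * s \<le> x$1 \<and> x$1 < of_int (fst z + 1) * s \<and>
                  of_int (snd z) * s \<le> x$2 \<and> x$2 < of_int (snd z + 1) * s}"

lemma cell_borel: "cell s z \<in> sets borel"
  unfolding cell_def by measurable

lemma cell_subset_cbox:
  "cell s z \<subseteq> cbox (vector [of_int (fst z) * s, of_int (snd z) * s])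
                (vector [of_int (fst z + 1) * s, of_int (snd z + 1) * s])"
  by (auto simp: cell_def mem_box_cart forall_2 intro: less_imp_le)

lemma bounded_cell: "bounded (cell s z)"
  using bounded_subset[OF bounded_cbox cell_subset_cbox] .

lemma measure_cell_le:
  assumes "s > 0"
  shows "measure lborel (cell s z) \<le> s\<^sup>2"
proof -
  let ?a = "vector [of_int (fst z) * s, of_int (snd z) * s] :: real^2"
  let ?b = "vector [of_int (fst z + 1) * s, of_int (snd z + 1) * s] :: real^2"
  have "measure lborel (cell s z) \<le> measure lborel (cbox ?a ?b)"
    by (intro measure_mono_fmeasurable cell_subset_cbox) (auto simp: cell_borel)
  also have "\<dots> = (\<Prod>i\<in>UNIV. ?b $ i - ?a $ i)"
    using assms by (intro content_cbox_cart) (auto simp: interval_ne_empty_cart forall_2)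
  also have "\<dots> = s\<^sup>2"
    by (simp add: UNIV_2 algebra_simps power2_eq_square)
  finally show ?thesis .
qed

lemma ex_cell: "s > 0 \<Longrightarrow> \<exists>z. x \<in> cell s z"
proof -
  assume "s > 0"
  have "of_int \<lfloor>t / s\<rfloor> * s \<le> t \<and> t < of_int (\<lfloor>t / s\<rfloor> + 1) * s" for t
    using floor_correct[of "t / s"] unfolding pos_le_divide_eq[OF \<open>s > 0\<close>] pos_divide_less_eq[OF \<open>s > 0\<close>] .
  then have "x \<in> cell s (\<lfloor>x$1 / s\<rfloor>, \<lfloor>x$2 / s\<rfloor>)" by (simp add: cell_def)
  then show ?thesis ..
qed

lemma cell_disjoint:
  assumes "s > 0" "x \<in> cell s z" "x \<in> cell s w"
  shows "z = w"
proof -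
  have "i = j" if "of_int i * s \<le> t" "t < of_int (i + 1) * s" "of_int j * s \<le> t" "t < of_int (j + 1) * s"
    for i j :: int and t
  proof -
    have "of_int i * s < of_int (j + 1) * s" "of_int j * s < of_int (i + 1) * s" using that by linarith+
    then have "i < j + 1" "j < i + 1" using assms(1) by (simp_all only: mult_less_cancel_right_pos of_int_less_iff)
    then show ?thesis by simp
  qed
  then show ?thesis using assms(2,3) unfolding cell_def prod_eq_iff by blast
qed

text \<open>The supremum norm on the integer lattice.\<close>

definition cheb :: "int \<times> int \<Rightarrow> int" where
  "cheb v = max \<bar>fst v\<bar> \<bar>snd v\<bar>"

text \<open>One cell width is lost because points may sit at the facing sides of their cells; the
  Euclidean distance dominates each coordinate difference.\<close>

lemma cell_dist_lower:
  assumes "s > 0" "X \<in> cell s w" "y \<in> cell s z"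
  shows "s * max 0 (of_int (cheb (w - z)) - 1) \<le> dist X y"
proof -
  have *: "s * (of_int \<bar>i - j\<bar> - 1) \<le> \<bar>t - u\<bar>"
    if "of_int i * s \<le> t" "t < of_int (i + 1) * s" "of_int j * s \<le> u" "u < of_int (j + 1) * s"
    for i j :: int and t u
  proof (cases "i \<ge> j")
    case True
    then have "s * (of_int \<bar>i - j\<bar> - 1) = of_int i * s - of_int (j + 1) * s" by (simp add: algebra_simps)
    also have "\<dots> \<le> t - u" using that by linarith
    finally show ?thesis by linarith
  next
    case False
    then have "s * (of_int \<bar>i - j\<bar> - 1) = of_int j * s - of_int (i + 1) * s" by (simp add: algebra_simps)
    also have "\<dots> \<le> u - t" using that by linarith
    finally show ?thesis by linarith
  qed
  have "s * (of_int \<bar>fst w - fst z\<bar> - 1) \<le> \<bar>X$1 - y$1\<bar>"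
    "s * (of_int \<bar>snd w - snd z\<bar> - 1) \<le> \<bar>X$2 - y$2\<bar>"
    using assms(2,3) unfolding cell_def mem_Collect_eq by (blast intro: *)+
  then have "s * (of_int (cheb (w - z)) - 1) \<le> max \<bar>X$1 - y$1\<bar> \<bar>X$2 - y$2\<bar>"
    unfolding cheb_def fst_diff snd_diff max_def by (auto split: if_splits)
  also have "\<dots> \<le> dist X y"
    using component_le_norm_cart[of "X - y" 1] component_le_norm_cart[of "X - y" 2]
    by (simp add: dist_norm)
  finally show ?thesis using assms(1) by (simp add: max_def)
qed

text \<open>The constant is crude: 2 * s for each coordinate, added up. Any fixed multiple of s
  would do, since it only enters the choice of P through l (4 * s).\<close>

lemma cell_dist_upper:
  assumes "s > 0" "X \<in> cell s z" "Y \<in> cell s w" "lattice_adj z w"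
  shows "dist X Y \<le> 4 * s"
proof -
  have *: "\<bar>t - u\<bar> \<le> 2 * s"
    if "of_int i * s \<le> t" "t < of_int (i + 1) * s" "of_int j * s \<le> u" "u < of_int (j + 1) * s" "\<bar>i - j\<bar> \<le> 1"
    for i j :: int and t u
  proof -
    have "of_int i * s \<le> of_int (j + 1) * s" "of_int j * s \<le> of_int (i + 1) * s"
      using that(5) assms(1) by (auto intro!: mult_right_mono)
    then show ?thesis using that(1-4) unfolding of_int_add distrib_right of_int_1 mult_1 by linarith
  qed
  have "\<bar>fst z - fst w\<bar> \<le> 1" "\<bar>snd z - snd w\<bar> \<le> 1"
    using assms(4) unfolding lattice_adj_def by linarith+
  then have "\<bar>X$1 - Y$1\<bar> \<le> 2 * s" "\<bar>X$2 - Y$2\<bar> \<le> 2 * s"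
    using assms(2,3) unfolding cell_def mem_Collect_eq by (blast intro: *)+
  then show ?thesis
    using norm_le_l1_cart[of "X - Y"] by (simp add: dist_norm sum_2)
qed

text \<open>With a numbering by naturals, sums over all cells become series whose partial sums
  involve finitely many counts, as the idcx order requires.\<close>

definition cell_enum :: "nat \<Rightarrow> int \<times> int" where
  "cell_enum = from_nat_into UNIV"

lemma bij_cell_enum: "bij cell_enum"
proof -
  have "infinite (UNIV :: (int \<times> int) set)"
    by (simp add: finite_prod infinite_UNIV_int)
  then show ?thesis
    unfolding cell_enum_def by (intro bij_betw_from_nat_into) auto
qed

lemma ex_cell_enum: "s > 0 \<Longrightarrow> \<exists>j. x \<in> cell s (cell_enum j)"
  using ex_cell[of s x] bij_cell_enum by (metis bij_pointE)

text \<open>This is \<open>l\<close> at the lower bound for the distance between points of two cells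
  with index difference \<open>v\<close>, hence an upper bound for the attenuation between
  them.\<close>

definition cell_attenuation :: "(real \<Rightarrow> real) \<Rightarrow> real \<Rightarrow> int \<times> int \<Rightarrow> real" where
  "cell_attenuation l s v = l (s * max 0 (of_int (cheb v) - 1))"

text \<open>A bound for the interference at all places of cell \<open>z\<close> at once, which
  depends on the configuration only through its cell counts.\<close>

definition cell_interference ::
    "(real \<Rightarrow> real) \<Rightarrow> real \<Rightarrow> (real^2) measure \<Rightarrow> int \<times> int \<Rightarrow> ennreal" where
  "cell_interference l s \<phi> z =
     (\<Sum>j. ennreal (cell_attenuation l s (cell_enum j - z)) * emeasure \<phi> (cell s (cell_enum j)))"

section \<open>Interference and SINR at the points of a cell\<close>

lemma attenuation_antimono:
  assumes "attenuation l" "\<forall>x\<ge>0. l x > 0" "0 \<le> x" "x \<le> y"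
  shows "l y \<le> l x"
proof (cases "x = y")
  case False
  then have "x < y" using assms(4) by simp
  \<comment> \<open>\<open>attenuation\<close> compares nonzero values only; positivity of
    \<open>l\<close> turns this into monotonicity on the whole half-line.\<close>
  moreover have "l x > 0" "l y > 0" using assms(2-4) by simp_all
  ultimately have "l y < l x" using assms(1,3) unfolding attenuation_def by auto
  then show ?thesis by simp
qed simp

lemma measurable_attenuation_dist:
  assumes "attenuation l"
  shows "(\<lambda>X::'b::euclidean_space. ennreal (l (dist X y))) \<in> borel_measurable borel"
proof -
  have "continuous_on UNIV (\<lambda>X. l (dist X y))"
    by (rule continuous_on_compose2[of "{0..}" l])
      (use assms in \<open>auto simp: attenuation_def intro!: continuous_intros\<close>)
  then have "(\<lambda>X. l (dist X y)) \<in> borel_measurable borel"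
    by (rule borel_measurable_continuous_onI)
  then show ?thesis by (rule measurable_compose) simp
qed

text \<open>Putting back the excluded points \<open>x\<close> and \<open>y\<close> only increases
  the integral. Each point of the configuration is then charged to its cell, with the largest
  attenuation possible from there.\<close>

lemma interference_le_cell_interference:
  fixes \<phi> :: "(real^2) measure"
  assumes l: "attenuation l" "\<forall>x\<ge>0. l x > 0" and \<phi>: "\<phi> \<in> configurations"
    and s: "s > 0" and y: "y \<in> cell s z"
  shows "interference l (remove_point x \<phi>) y \<le> cell_interference l s \<phi> z"
proof -
  have sets: "sets \<phi> = sets borel" by (rule configuration_sets[OF \<phi>])
  have bm: "borel_measurable \<phi> = borel_measurable (borel :: (real^2) measure)"
    by (rule measurable_cong_sets) (simp_all add: sets)
  define f where "f X = ennreal (l (dist X y))" for X :: "real^2"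
  have f: "f \<in> borel_measurable \<phi>"
    unfolding f_def bm by (rule measurable_attenuation_dist[OF l(1)])
  have ind: "(indicator A :: _ \<Rightarrow> ennreal) \<in> borel_measurable \<phi>" if "A \<in> sets borel" for A
    using that by (intro borel_measurable_indicator) (simp add: sets)
  have "interference l (remove_point x \<phi>) y
      = (\<integral>\<^sup>+X. indicator (- {x}) X * (f X * indicator (- {y}) X) \<partial>\<phi>)"
    unfolding interference_def remove_point_def f_def[symmetric]
    using f ind by (intro nn_integral_density borel_measurable_times) auto
  also have "\<dots> \<le> (\<integral>\<^sup>+X. f X \<partial>\<phi>)"
    by (intro nn_integral_mono) (auto simp: indicator_def)
  also have "\<dots> \<le> (\<integral>\<^sup>+X. (\<Sum>j. ennreal (cell_attenuation l s (cell_enum j - z))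
      * indicator (cell s (cell_enum j)) X) \<partial>\<phi>)"
  proof (rule nn_integral_mono)
    fix X
    obtain j where j: "X \<in> cell s (cell_enum j)" using ex_cell_enum[OF s] by blast
    let ?g = "\<lambda>j. ennreal (cell_attenuation l s (cell_enum j - z)) * indicator (cell s (cell_enum j)) X"
    have "l (dist X y) \<le> cell_attenuation l s (cell_enum j - z)"
      unfolding cell_attenuation_def using s
      by (intro attenuation_antimono[OF l] cell_dist_lower[OF s j y]) auto
    then have "f X \<le> sum ?g {j}" using j by (simp add: f_def ennreal_leI)
    also have "\<dots> \<le> suminf ?g" by (intro sum_le_suminf) auto
    finally show "f X \<le> suminf ?g" .
  qed
  also have "\<dots> = (\<Sum>j. \<integral>\<^sup>+X. ennreal (cell_attenuation l s (cell_enum j - z))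
      * indicator (cell s (cell_enum j)) X \<partial>\<phi>)"
    by (intro nn_integral_suminf borel_measurable_times_ennreal borel_measurable_const ind cell_borel)
  also have "\<dots> = cell_interference l s \<phi> z"
    unfolding cell_interference_def
    by (intro suminf_cong nn_integral_cmult_indicator) (simp add: sets cell_borel)
  finally show ?thesis .
qed

lemma ennreal_inverse_antimono: "x \<le> y \<Longrightarrow> inverse y \<le> inverse (x :: ennreal)"
  including ennreal.lifting by transfer (rule ereal_inverse_antimono)

text \<open>Scaled interference contributes at most another \<open>N\<close>, so the denominator is
  at most 2 * N, while the numerator is at least P * l (4 * s); this is the origin of the factor 2
  in the condition on \<open>P\<close>.\<close>

lemma SINR_gt_threshold:
  fixes \<phi> :: "(real^2) measure"
  assumes l: "attenuation l" "\<forall>x\<ge>0. l x > 0" and \<phi>: "\<phi> \<in> configurations"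
    and s: "s > 0" and X: "X \<in> cell s z" and Y: "Y \<in> cell s w" "lattice_adj z w"
    and pos: "N > 0" "T > 0" "P > 0" "\<gamma> > 0" "K \<ge> 0"
    and K: "cell_interference l s \<phi> w \<le> ennreal K" "\<gamma> * P * K \<le> N"
    and P: "2 * N * T < P * l (4 * s)"
  shows "ennreal T < SINR P N l X Y \<phi> \<gamma>"
proof -
  have "ennreal N + ennreal (\<gamma> * P) * interference l (remove_point X \<phi>) Y
      \<le> ennreal N + ennreal (\<gamma> * P) * ennreal K"
    using interference_le_cell_interference[OF l \<phi> s Y(1)] K(1)
    by (intro add_left_mono mult_left_mono) (auto intro: order_trans)
  also have "\<dots> = ennreal (N + \<gamma> * P * K)"
    using pos by (simp add: ennreal_mult[symmetric])
  also have "\<dots> \<le> ennreal (2 * N)"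
    using K(2) by (intro ennreal_leI) simp
  finally have den: "ennreal N + ennreal (\<gamma> * P) * interference l (remove_point X \<phi>) Y \<le> ennreal (2 * N)" .
  have "l (4 * s) \<le> l (dist X Y)"
    by (intro attenuation_antimono[OF l] cell_dist_upper[OF s X Y]) auto
  then have "P * l (4 * s) \<le> P * l (dist X Y)" using pos by simp
  then have "2 * N * T < P * l (dist X Y)" using P by linarith
  then have "T < P * l (dist X Y) / (2 * N)" using pos by (simp add: field_simps)
  then have "ennreal T < ennreal (P * l (dist X Y) / (2 * N))"
    using pos by (intro ennreal_lessI) auto
  also have "\<dots> = ennreal (P * l (dist X Y)) / ennreal (2 * N)"
  proof (rule divide_ennreal[symmetric])
    have "0 < l (dist X Y)" using l(2) by simp
    then show "0 \<le> P * l (dist X Y)" using pos by simp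
  qed (use pos in simp)
  also have "\<dots> \<le> SINR P N l X Y \<phi> \<gamma>"
    unfolding SINR_def divide_ennreal_def
    using den by (intro mult_left_mono ennreal_inverse_antimono) auto
  finally show ?thesis .
qed

text \<open>One point is picked in each good cell. Disjointness of the cells makes the choice
  injective, so infinitely many reachable cells give infinitely many points in one
  component.\<close>

lemma percolates_of_infinite_component:
  assumes s: "s > 0" and pts: "\<And>z. G z \<Longrightarrow> \<exists>x\<in>cell s z. x \<in> V"
    and E: "\<And>z w X Y. G z \<Longrightarrow> G w \<Longrightarrow> lattice_adj z w \<Longrightarrow> X \<in> cell s z \<Longrightarrow> Y \<in> cell s w \<Longrightarrow>
      X \<in> V \<Longrightarrow> Y \<in> V \<Longrightarrow> (X, Y) \<in> E"
    and u: "G u" "infinite {v. (u, v) \<in> (lattice_edges G)\<^sup>*}"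
  shows "percolates V E"
proof -
  obtain p where p: "\<And>z. G z \<Longrightarrow> p z \<in> cell s z \<and> p z \<in> V"
    using pts by metis
  let ?R = "{v. (u, v) \<in> (lattice_edges G)\<^sup>*}"
  have reach: "G v \<and> (p u, p v) \<in> E\<^sup>*" if "(u, v) \<in> (lattice_edges G)\<^sup>*" for v
    using that
  proof (induction rule: rtrancl_induct)
    case base
    then show ?case using u by simp
  next
    case (step v w)
    then have "G v" "G w" "lattice_adj v w" by (auto simp: lattice_edges_def)
    then have "(p v, p w) \<in> E" using p E by blast
    then show ?case using step.IH \<open>G w\<close> by (auto intro: rtrancl_into_rtrancl)
  qed
  have "inj_on p ?R"
  proof (rule inj_onI)
    fix v w assume "v \<in> ?R" "w \<in> ?R" "p v = p w"
    then have "p v \<in> cell s v" "p v \<in> cell s w" using reach p by (blast, metis reach p mem_Collect_eq)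
    then show "v = w" by (rule cell_disjoint[OF s])
  qed
  then have "infinite (p ` ?R)" using u(2) finite_imageD by blast
  moreover have "p ` ?R \<subseteq> Restr (E\<^sup>*) V `` {p u}" using reach p u(1) by blast
  ultimately have "infinite (Restr (E\<^sup>*) V `` {p u})" using finite_subset by blast
  moreover have "Restr (E\<^sup>*) V `` {p u} \<in> connected_components V E"
    unfolding connected_components_def by (rule quotientI) (use p u(1) in blast)
  ultimately show ?thesis unfolding percolates_def by blast
qed

subsection \<open>Total attenuation between cells\<close>

text \<open>The shell is covered by the four sides of a square with 2n + 1 lattice points each;
  corners are counted twice.\<close>

lemma cheb_shell_card: "card {v. cheb v = int n} \<le> 8 * n + 4" "finite {v. cheb v = int n}"
proof -
  let ?I = "{- int n..int n}" and ?E = "{- int n, int n}"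
  let ?U = "?E \<times> ?I \<union> ?I \<times> ?E"
  have sub: "{v. cheb v = int n} \<subseteq> ?U"
  proof
    fix v assume "v \<in> {v. cheb v = int n}"
    then have m: "max \<bar>fst v\<bar> \<bar>snd v\<bar> = int n" by (simp add: cheb_def)
    then have "\<bar>fst v\<bar> \<le> int n" "\<bar>snd v\<bar> \<le> int n" "\<bar>fst v\<bar> = int n \<or> \<bar>snd v\<bar> = int n"
      by linarith+
    then have "fst v \<in> ?I" "snd v \<in> ?I" "fst v \<in> ?E \<or> snd v \<in> ?E" by auto
    then show "v \<in> ?U" by (cases v) auto
  qed
  show "finite {v. cheb v = int n}" by (rule finite_subset[OF sub]) simp
  have "card ?E \<le> 2" using card_insert_le_m1[of 2 "{int n}" "- int n"] by simp
  have "card {v. cheb v = int n} \<le> card ?U" by (rule card_mono[OF _ sub]) simp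
  also have "\<dots> \<le> card (?E \<times> ?I) + card (?I \<times> ?E)" by (rule card_Un_le)
  also have "\<dots> = 2 * card ?E * (2 * n + 1)" by (simp add: card_cartesian_product nat_add_distrib nat_mult_distrib)
  also have "\<dots> \<le> 2 * 2 * (2 * n + 1)"
    using \<open>card ?E \<le> 2\<close> by (intro mult_right_mono mult_left_mono) auto
  finally show "card {v. cheb v = int n} \<le> 8 * n + 4" by simp
qed

text \<open>Integral comparison. On the interval from s(m + 1) to s(m + 2) the integrand x * l x is
  at least s(m + 1) l(s(m + 2)) by monotonicity of \<open>l\<close>, and the interval has length s.
  The weight m + 1 reflects the number of cells in a shell of the plane.\<close>

lemma suminf_attenuation_finite:
  assumes l: "attenuation l" "\<forall>x\<ge>0. l x > 0" and s: "s > 0"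
  shows "(\<Sum>m::nat. ennreal (real (m + 1) * l (s * real (m + 2)))) < \<infinity>"
proof -
  define F where "F x = indicator {0..} x *\<^sub>R (x * l x)" for x :: real
  have int: "integrable lborel F"
    using l(1) unfolding attenuation_def set_integrable_def F_def by auto
  then have F[measurable]: "(\<lambda>x. ennreal (F x)) \<in> borel_measurable lborel"
    by (auto dest: borel_measurable_integrable)
  \<comment> \<open>As a measure with density, the integral over the disjoint intervals is summed by
    countable additivity.\<close>
  define \<mu> where "\<mu> = density lborel (\<lambda>x. ennreal (F x))"
  define I where "I m = {s * real (m + 1) ..< s * real (m + 2)}" for m :: nat
  have I: "I m \<in> sets \<mu>" for m by (simp add: I_def \<mu>_def)
  have disj: "disjoint_family I"
    unfolding disjoint_family_on_def
  proof (intro ballI impI)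
    fix m n :: nat assume "m \<noteq> n"
    have "I m \<inter> I n = {}" if "m < n" for m n
    proof -
      have "s * real (m + 2) \<le> s * real (n + 1)" using that s by (intro mult_left_mono) auto
      then show ?thesis by (auto simp: I_def)
    qed
    then show "I m \<inter> I n = {}" using \<open>m \<noteq> n\<close> by (metis Int_commute nat_neq_iff)
  qed
  have term_le: "ennreal (s * s) * ennreal (real (m + 1) * l (s * real (m + 2))) \<le> emeasure \<mu> (I m)" for m
  proof -
    have pos: "0 \<le> s * real (m + 1)" "0 \<le> s * real (m + 2)" using s by simp_all
    have "ennreal (s * s) * ennreal (real (m + 1) * l (s * real (m + 2)))
        = ennreal (s * real (m + 1) * l (s * real (m + 2))) * ennreal (s * real (m + 2) - s * real (m + 1))"
      using s pos l(2) by (simp add: ennreal_mult[symmetric] less_imp_le algebra_simps)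
    also have "\<dots> = (\<integral>\<^sup>+x. ennreal (s * real (m + 1) * l (s * real (m + 2))) * indicator (I m) x \<partial>lborel)"
    proof -
      have "s * real (m + 1) \<le> s * real (m + 2)" using s by simp
      then have "ennreal (s * real (m + 2) - s * real (m + 1)) = emeasure lborel (I m)"
        unfolding I_def by (rule emeasure_lborel_Ico[symmetric])
      then show ?thesis
        by (simp only:) (rule nn_integral_cmult_indicator[symmetric], simp add: I_def)
    qed
    also have "\<dots> \<le> (\<integral>\<^sup>+x. ennreal (F x) * indicator (I m) x \<partial>lborel)"
    proof (rule nn_integral_mono)
      fix x
      have "s * real (m + 1) * l (s * real (m + 2)) \<le> F x" if "x \<in> I m"
      proof -
        have x: "s * real (m + 1) \<le> x" "x < s * real (m + 2)" "0 \<le> x"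
          using that pos by (auto simp: I_def)
        then have "s * real (m + 1) * l (s * real (m + 2)) \<le> x * l x"
          using l(2) pos by (intro mult_mono attenuation_antimono[OF l]) (auto simp: less_imp_le)
        then show ?thesis using x by (simp add: F_def)
      qed
      then show "ennreal (s * real (m + 1) * l (s * real (m + 2))) * indicator (I m) x
          \<le> ennreal (F x) * indicator (I m) x"
        by (auto simp: indicator_def intro: ennreal_leI)
    qed
    also have "\<dots> = emeasure \<mu> (I m)"
      unfolding \<mu>_def by (rule emeasure_density[symmetric, OF F]) (simp add: I_def)
    finally show ?thesis .
  qed
  have "ennreal (s * s) * (\<Sum>m. ennreal (real (m + 1) * l (s * real (m + 2))))
      = (\<Sum>m. ennreal (s * s) * ennreal (real (m + 1) * l (s * real (m + 2))))"
    by (rule ennreal_suminf_cmult[symmetric])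
  also have "\<dots> \<le> (\<Sum>m. emeasure \<mu> (I m))"
    by (rule suminf_le[OF term_le]) auto
  also have "\<dots> = emeasure \<mu> (\<Union>m. I m)"
    using I disj by (intro suminf_emeasure) auto
  also have "\<dots> \<le> emeasure \<mu> (space \<mu>)" by (rule emeasure_space)
  also have "\<dots> = (\<integral>\<^sup>+x. ennreal (F x) \<partial>lborel)"
    unfolding \<mu>_def by (subst emeasure_density) (auto simp: F)
  also have "\<dots> \<le> (\<integral>\<^sup>+x. ennreal (norm (F x)) \<partial>lborel)"
    by (intro nn_integral_mono ennreal_leI) simp
  also have "\<dots> < \<infinity>" using int by (simp add: integrable_iff_bounded)
  finally have "ennreal (s * s) * (\<Sum>m. ennreal (real (m + 1) * l (s * real (m + 2)))) < \<infinity>" .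
  then show ?thesis using s by (auto simp: ennreal_mult_less_top)
qed

text \<open>Cells are grouped into shells of constant \<open>cheb\<close>, of size at most 8n + 4,
  on which the attenuation is constant.\<close>

lemma nn_integral_cell_attenuation_finite:
  assumes l: "attenuation l" "\<forall>x\<ge>0. l x > 0" and s: "s > 0"
  shows "(\<integral>\<^sup>+v. ennreal (cell_attenuation l s v) \<partial>count_space UNIV) < \<infinity>"
proof -
  define h where "h n = l (s * max 0 (real n - 1))" for n :: nat
  define S where "S n = {v. cheb v = int n}" for n
  define t where "t n = ennreal (real (8 * n + 4)) * ennreal (h n)" for n
  have "(\<integral>\<^sup>+v. ennreal (cell_attenuation l s v) \<partial>count_space UNIV)
      \<le> (\<integral>\<^sup>+v. (\<Sum>n. ennreal (h n) * indicator (S n) v) \<partial>count_space UNIV)"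
  proof (rule nn_integral_mono)
    fix v
    have n: "cheb v = int (nat (cheb v))" by (simp add: cheb_def)
    have "real_of_int (cheb v) = real (nat (cheb v))" using n by (metis of_int_of_nat_eq)
    then have "cell_attenuation l s v = h (nat (cheb v))"
      by (simp only: cell_attenuation_def h_def)
    moreover have "v \<in> S (nat (cheb v))" using n by (simp only: S_def mem_Collect_eq)
    ultimately have "ennreal (cell_attenuation l s v) = (\<Sum>n\<in>{nat (cheb v)}. ennreal (h n) * indicator (S n) v)"
      by simp
    also have "\<dots> \<le> (\<Sum>n. ennreal (h n) * indicator (S n) v)"
      by (intro sum_le_suminf) auto
    finally show "ennreal (cell_attenuation l s v) \<le> (\<Sum>n. ennreal (h n) * indicator (S n) v)" .
  qed
  also have "\<dots> = (\<Sum>n. ennreal (h n) * emeasure (count_space UNIV) (S n))"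
    by (simp add: nn_integral_suminf nn_integral_cmult_indicator)
  also have "\<dots> \<le> (\<Sum>n. t n)"
  proof (intro suminf_le allI)
    fix n
    have "emeasure (count_space UNIV) (S n) = ennreal (real (card (S n)))"
      using cheb_shell_card(2)[of n] by (simp add: S_def ennreal_of_nat_eq_real_of_nat)
    also have "\<dots> \<le> ennreal (real (8 * n + 4))"
      using cheb_shell_card(1)[of n] by (intro ennreal_leI) (simp only: S_def of_nat_le_iff)
    finally show "ennreal (h n) * emeasure (count_space UNIV) (S n) \<le> t n"
      unfolding t_def by (subst mult.commute) (rule mult_right_mono, auto)
  qed auto
  \<comment> \<open>With n = m + 3 the argument s(n - 1) of \<open>l\<close> becomes s(m + 2),
    matching the convergent series, and 8n + 4 = 8m + 28 is at most 28(m + 1).\<close>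
  also have "\<dots> = (\<Sum>m. t (m + 3)) + (\<Sum>n<3. t n)"
    by (rule suminf_offset) auto
  also have "\<dots> < \<infinity>"
  proof -
    have "t (m + 3) \<le> ennreal 28 * ennreal (real (m + 1) * l (s * real (m + 2)))" for m
    proof -
      have "0 < l (s * real (m + 2))" using l(2) s by simp
      moreover have "real (8 * (m + 3) + 4) \<le> 28 * real (m + 1)" by simp
      ultimately have "real (8 * (m + 3) + 4) * l (s * real (m + 2)) \<le> 28 * real (m + 1) * l (s * real (m + 2))"
        by (intro mult_right_mono) auto
      moreover have "t (m + 3) = ennreal (real (8 * (m + 3) + 4) * l (s * real (m + 2)))"
      proof -
        have "h (m + 3) = l (s * real (m + 2))" by (simp add: h_def algebra_simps)
        then show ?thesis
          unfolding t_def using \<open>0 < l _\<close> by (simp only:) (rule ennreal_mult[symmetric], auto)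
      qed
      moreover have "ennreal 28 * ennreal (real (m + 1) * l (s * real (m + 2)))
          = ennreal (28 * (real (m + 1) * l (s * real (m + 2))))"
        using \<open>0 < l _\<close> by (intro ennreal_mult[symmetric] mult_nonneg_nonneg) auto
      ultimately show ?thesis by (simp only: mult.assoc) (rule ennreal_leI)
    qed
    then have "(\<Sum>m. t (m + 3)) \<le> (\<Sum>m. ennreal 28 * ennreal (real (m + 1) * l (s * real (m + 2))))"
      by (intro suminf_le) auto
    also have "\<dots> = ennreal 28 * (\<Sum>m. ennreal (real (m + 1) * l (s * real (m + 2))))"
      by (rule ennreal_suminf_cmult)
    also have "\<dots> < \<infinity>"
      using suminf_attenuation_finite[OF l s] by (simp add: ennreal_mult_less_top)
    finally have "(\<Sum>m. t (m + 3)) < \<infinity>" .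
    moreover have "(\<Sum>n<3. t n) < \<infinity>"
      by (simp add: t_def ennreal_mult_less_top)
    ultimately show ?thesis by simp
  qed
  finally show ?thesis .
qed

lemma cheb_minus: "cheb (v - w) = cheb (w - v)"
  by (simp add: cheb_def abs_minus_commute)

lemma cell_attenuation_nonneg:
  assumes "\<forall>x\<ge>0. l x > 0" "s > 0"
  shows "0 \<le> cell_attenuation l s v"
  unfolding cell_attenuation_def using assms by (intro less_imp_le) simp

text \<open>The kernel depends on the difference of two cells only and is symmetric, so one constant
  bounds both the total weight felt by a cell and the total influence of a cell on any finite set of
  cells.\<close>

lemma total_cell_attenuation:
  assumes l: "attenuation l" "\<forall>x\<ge>0. l x > 0" and s: "s > 0"
  shows "\<exists>S>0. (\<forall>z. (\<Sum>j. ennreal (cell_attenuation l s (cell_enum j - z))) \<le> ennreal S) \<and>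
    (\<forall>w A. finite A \<longrightarrow> (\<Sum>z\<in>A. cell_attenuation l s (w - z)) \<le> S)"
proof -
  let ?a = "\<lambda>v. ennreal (cell_attenuation l s v)"
  \<comment> \<open>The added 1 makes \<open>S\<close> positive, as it will be a divisor.\<close>
  define S where "S = enn2real (\<integral>\<^sup>+v. ?a v \<partial>count_space UNIV) + 1"
  have S: "(\<integral>\<^sup>+v. ?a v \<partial>count_space UNIV) \<le> ennreal S"
    using nn_integral_cell_attenuation_finite[OF l s]
    by (cases "\<integral>\<^sup>+v. ?a v \<partial>count_space UNIV") (auto simp: S_def intro!: ennreal_leI)
  have shift: "(\<integral>\<^sup>+w. ?a (w - z) \<partial>count_space UNIV) = (\<integral>\<^sup>+v. ?a v \<partial>count_space UNIV)" for z
    by (rule nn_integral_bij_count_space)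
      (auto intro!: bij_betwI[where g="\<lambda>v. v + z"])
  have "S > 0" by (simp add: S_def add_nonneg_pos)
  show ?thesis
  proof (intro exI[of _ S] conjI allI impI)
    show "S > 0" by fact
    show "(\<Sum>j. ?a (cell_enum j - z)) \<le> ennreal S" for z
    proof -
      have "(\<Sum>j. ?a (cell_enum j - z)) = (\<integral>\<^sup>+j. ?a (cell_enum j - z) \<partial>count_space UNIV)"
        by (rule nn_integral_count_space_nat[symmetric])
      also have "\<dots> = (\<integral>\<^sup>+w. ?a (w - z) \<partial>count_space UNIV)"
        by (rule nn_integral_bij_count_space[OF bij_cell_enum])
      finally show ?thesis using S shift by simp
    qed
    show "(\<Sum>z\<in>A. cell_attenuation l s (w - z)) \<le> S" if "finite A" for w A
    proof -
      have nn: "0 \<le> cell_attenuation l s v" for v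
        by (rule cell_attenuation_nonneg[OF l(2) s])
      have "ennreal (\<Sum>z\<in>A. cell_attenuation l s (w - z)) = (\<Sum>z\<in>A. ?a (z - w))"
        using nn by (simp add: sum_ennreal[symmetric] cell_attenuation_def cheb_minus[of w] del: sum_ennreal)
      also have "\<dots> = (\<integral>\<^sup>+z. ?a (z - w) \<partial>count_space A)"
        by (rule nn_integral_count_space_finite[symmetric, OF that])
      also have "\<dots> = (\<integral>\<^sup>+z. ?a (z - w) * indicator A z \<partial>count_space UNIV)"
        by (simp add: nn_integral_restrict_space[symmetric] restrict_count_space)
      also have "\<dots> \<le> (\<integral>\<^sup>+z. ?a (z - w) \<partial>count_space UNIV)"
        by (intro nn_integral_mono) (auto simp: indicator_def)
      also have "\<dots> \<le> ennreal S" using S shift by simp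
      finally show ?thesis
        using ennreal_le_iff[of S] \<open>S > 0\<close> by simp
    qed
  qed
qed

section \<open>Emptiness probabilities of a stationary weakly sub-Poisson process\<close>

lemma space_config_space: "space (config_space :: 'b::euclidean_space measure measure) = configurations"
  unfolding config_space_def by (subst space_Sup_eq_UN) auto

lemma measurable_emeasure_config_space:
  "B \<in> sets borel \<Longrightarrow> (\<lambda>\<phi>. emeasure \<phi> B) \<in> borel_measurable config_space"
  unfolding config_space_def
  by (rule measurable_SUP1[where i=B]) (auto intro: measurable_vimage_algebra1)

lemma measurable_config_spaceI:
  assumes "\<And>\<omega>. \<omega> \<in> space M \<Longrightarrow> \<Psi> \<omega> \<in> configurations"
    and "\<And>B. B \<in> sets borel \<Longrightarrow> (\<lambda>\<omega>. emeasure (\<Psi> \<omega>) B) \<in> borel_measurable M"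
  shows "\<Psi> \<in> M \<rightarrow>\<^sub>M config_space"
  unfolding config_space_def
  by (rule measurable_SUP2) (use assms in \<open>auto intro!: measurable_vimage_algebra2\<close>)

lemma point_process_configuration:
  "point_process M \<Phi> \<Longrightarrow> \<omega> \<in> space M \<Longrightarrow> \<Phi> \<omega> \<in> configurations"
  unfolding point_process_def using measurable_space[of \<Phi> M config_space \<omega>]
  by (simp add: space_config_space)

lemma point_process_measurable:
  assumes "point_process M \<Phi>" "B \<in> sets borel"
  shows "(\<lambda>\<omega>. emeasure (\<Phi> \<omega>) B) \<in> borel_measurable M"
  using measurable_compose[OF _ measurable_emeasure_config_space[OF assms(2)]] assms(1)
  unfolding point_process_def by blast

text \<open>The mean measure is an integral against the law on \<open>config_space\<close>. Before
  equality of laws can be used, the translated process \<open>\<Psi>\<close> has to be shown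
  measurable into that space.\<close>

lemma stationary_mean_measure:
  assumes pp: "point_process M \<Phi>" and st: "stationary M \<Phi>" and B: "B \<in> sets borel"
  shows "mean_measure M \<Phi> ((\<lambda>x. x + a) -` B) = mean_measure M \<Phi> B"
proof -
  define \<Psi> where "\<Psi> \<omega> = distr (\<Phi> \<omega>) borel (\<lambda>x. x + a)" for \<omega>
  have shift: "(\<lambda>x. x + a) \<in> \<Phi> \<omega> \<rightarrow>\<^sub>M borel" "space (\<Phi> \<omega>) = UNIV" if "\<omega> \<in> space M" for \<omega>
  proof -
    have sets: "sets (\<Phi> \<omega>) = sets borel"
      by (rule configuration_sets[OF point_process_configuration[OF pp that]])
    show "space (\<Phi> \<omega>) = UNIV" using sets_eq_imp_space_eq[OF sets] by simp
    have "(\<lambda>x. x + a) \<in> borel_measurable borel" by simp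
    then show "(\<lambda>x. x + a) \<in> \<Phi> \<omega> \<rightarrow>\<^sub>M borel"
      by (subst measurable_cong_sets[OF sets refl])
  qed
  have vim: "(\<lambda>x. x + a) -` C \<in> sets borel" if "C \<in> sets borel" for C
    using measurable_sets[of "\<lambda>x. x + a" borel borel C] that by simp
  have em: "emeasure (\<Psi> \<omega>) C = emeasure (\<Phi> \<omega>) ((\<lambda>x. x + a) -` C)"
    if "\<omega> \<in> space M" "C \<in> sets borel" for \<omega> C
    unfolding \<Psi>_def using emeasure_distr[OF shift(1)[OF that(1)] that(2)] shift(2)[OF that(1)] by simp
  have \<Psi>: "\<Psi> \<in> M \<rightarrow>\<^sub>M config_space"
  proof (rule measurable_config_spaceI)
    fix \<omega> assume \<omega>: "\<omega> \<in> space M"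
    have "emeasure (\<Psi> \<omega>) C \<in> \<nat>" if "C \<in> sets borel" "bounded C" for C
    proof -
      have "(\<lambda>x. x + a) -` C = (\<lambda>x. x + (- a)) ` C" by (auto simp: image_iff) (metis add_diff_cancel)
      then have "bounded ((\<lambda>x. x + a) -` C)"
        using bounded_translation[OF that(2), of "- a"] by (simp add: add.commute)
      then show ?thesis
        using configuration_Nats[OF point_process_configuration[OF pp \<omega>] vim[OF that(1)]]
          em[OF \<omega> that(1)] by simp
    qed
    then show "\<Psi> \<omega> \<in> configurations" by (simp add: configurations_def \<Psi>_def)
  next
    fix C :: "'b set" assume C: "C \<in> sets borel"
    have "(\<lambda>\<omega>. emeasure (\<Phi> \<omega>) ((\<lambda>x. x + a) -` C)) \<in> borel_measurable M"
      by (rule point_process_measurable[OF pp vim[OF C]])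
    then show "(\<lambda>\<omega>. emeasure (\<Psi> \<omega>) C) \<in> borel_measurable M"
      using em C by (subst measurable_cong) auto
  qed
  have \<Phi>: "\<Phi> \<in> M \<rightarrow>\<^sub>M config_space" using pp by (simp add: point_process_def)
  have "mean_measure M \<Phi> ((\<lambda>x. x + a) -` B) = (\<integral>\<^sup>+\<omega>. emeasure (\<Psi> \<omega>) B \<partial>M)"
    unfolding mean_measure_def using em B by (intro nn_integral_cong) auto
  also have "\<dots> = (\<integral>\<^sup>+\<phi>. emeasure \<phi> B \<partial>distr M config_space \<Psi>)"
    using \<Psi> measurable_emeasure_config_space[OF B] by (intro nn_integral_distr[symmetric]) auto
  also have "distr M config_space \<Psi> = distr M config_space \<Phi>"
    using st unfolding stationary_def \<Psi>_def by blast
  also have "(\<integral>\<^sup>+\<phi>. emeasure \<phi> B \<partial>distr M config_space \<Phi>) = mean_measure M \<Phi> B"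
    unfolding mean_measure_def
    using \<Phi> measurable_emeasure_config_space[OF B] by (intro nn_integral_distr) auto
  finally show ?thesis .
qed

lemma mean_measure_mono:
  assumes pp: "point_process M \<Phi>" and "A \<subseteq> B" "B \<in> sets borel"
  shows "mean_measure M \<Phi> A \<le> mean_measure M \<Phi> B"
  unfolding mean_measure_def
proof (rule nn_integral_mono)
  fix \<omega> assume "\<omega> \<in> space M"
  then have "sets (\<Phi> \<omega>) = sets borel"
    by (rule configuration_sets[OF point_process_configuration[OF pp]])
  then show "emeasure (\<Phi> \<omega>) A \<le> emeasure (\<Phi> \<omega>) B"
    using assms(2,3) by (intro emeasure_mono) auto
qed

lemma mean_measure_cells:
  assumes pp: "point_process M \<Phi>" and s: "s > 0" and A: "finite A"
  shows "mean_measure M \<Phi> (\<Union>z\<in>A. cell s z) = (\<Sum>z\<in>A. mean_measure M \<Phi> (cell s z))"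
proof -
  have "mean_measure M \<Phi> (\<Union>z\<in>A. cell s z) = (\<integral>\<^sup>+\<omega>. (\<Sum>z\<in>A. emeasure (\<Phi> \<omega>) (cell s z)) \<partial>M)"
    unfolding mean_measure_def
  proof (rule nn_integral_cong)
    fix \<omega> assume "\<omega> \<in> space M"
    then have "sets (\<Phi> \<omega>) = sets borel"
      by (rule configuration_sets[OF point_process_configuration[OF pp]])
    moreover have "disjoint_family_on (cell s) A"
      using cell_disjoint[OF s] unfolding disjoint_family_on_def by blast
    ultimately show "emeasure (\<Phi> \<omega>) (\<Union>z\<in>A. cell s z) = (\<Sum>z\<in>A. emeasure (\<Phi> \<omega>) (cell s z))"
      using A cell_borel by (intro sum_emeasure[symmetric]) auto
  qed
  also have "\<dots> = (\<Sum>z\<in>A. mean_measure M \<Phi> (cell s z))"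
    unfolding mean_measure_def
    by (intro nn_integral_sum point_process_measurable[OF pp cell_borel])
  finally show ?thesis .
qed

lemma cell_vimage:
  "cell s z = (\<lambda>x. x + vector [- of_int (fst z) * s, - of_int (snd z) * s]) -` cell s (0, 0)"
  by (auto simp: cell_def algebra_simps)

lemma mean_measure_cell:
  assumes "point_process M \<Phi>" "stationary M \<Phi>"
  shows "mean_measure M \<Phi> (cell s z) = mean_measure M \<Phi> (cell s (0, 0))"
  by (subst cell_vimage) (rule stationary_mean_measure[OF assms cell_borel])

text \<open>Countably many translates of the unit cell, all of the same mean, cover the plane; if
  that mean were 0, so would be the total.\<close>

lemma mean_measure_unit_cell_pos:
  assumes pp: "point_process M \<Phi>" and st: "stationary M \<Phi>" and pos: "mean_measure M \<Phi> UNIV > 0"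
  shows "mean_measure M \<Phi> (cell 1 (0, 0)) > 0"
proof (rule ccontr)
  assume "\<not> ?thesis"
  then have 0: "mean_measure M \<Phi> (cell 1 z) = 0" for z
    using mean_measure_cell[OF pp st, of 1 z] by simp
  have "mean_measure M \<Phi> UNIV \<le> (\<integral>\<^sup>+\<omega>. (\<Sum>j. emeasure (\<Phi> \<omega>) (cell 1 (cell_enum j))) \<partial>M)"
    unfolding mean_measure_def
  proof (rule nn_integral_mono)
    fix \<omega> assume "\<omega> \<in> space M"
    then have sets: "sets (\<Phi> \<omega>) = sets borel"
      by (rule configuration_sets[OF point_process_configuration[OF pp]])
    have "(UNIV :: (real^2) set) = (\<Union>j. cell 1 (cell_enum j))"
      using ex_cell_enum[of 1] by (auto simp: set_eq_iff)
    then have "emeasure (\<Phi> \<omega>) UNIV = emeasure (\<Phi> \<omega>) (\<Union>j. cell 1 (cell_enum j))" by simp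
    also have "\<dots> \<le> (\<Sum>j. emeasure (\<Phi> \<omega>) (cell 1 (cell_enum j)))"
      by (intro emeasure_subadditive_countably) (simp add: image_subset_iff sets cell_borel)
    finally show "emeasure (\<Phi> \<omega>) UNIV \<le> (\<Sum>j. emeasure (\<Phi> \<omega>) (cell 1 (cell_enum j)))" .
  qed
  also have "\<dots> = (\<Sum>j. mean_measure M \<Phi> (cell 1 (cell_enum j)))"
    unfolding mean_measure_def
    by (intro nn_integral_suminf point_process_measurable[OF pp cell_borel])
  also have "\<dots> = 0" using 0 by simp
  finally show False using pos by simp
qed

text \<open>A single row of unit cells inside the large square already gives a mean count that tends
  to infinity with the side length.\<close>

lemma mean_measure_cell_linear:
  assumes pp: "point_process M \<Phi>" and st: "stationary M \<Phi>" and n: "n > 0"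
  shows "of_nat n * mean_measure M \<Phi> (cell 1 (0, 0)) \<le> mean_measure M \<Phi> (cell (real n) (0, 0))"
proof -
  let ?A = "(\<lambda>i. (int i, 0 :: int)) ` {..<n}"
  have "card ?A = n" by (subst card_image) (auto simp: inj_on_def)
  then have "of_nat n * mean_measure M \<Phi> (cell 1 (0, 0)) = (\<Sum>z\<in>?A. mean_measure M \<Phi> (cell 1 (0, 0)))"
    by simp
  also have "\<dots> = (\<Sum>z\<in>?A. mean_measure M \<Phi> (cell 1 z))"
    by (intro sum.cong refl mean_measure_cell[OF pp st, symmetric])
  also have "\<dots> = mean_measure M \<Phi> (\<Union>z\<in>?A. cell 1 z)"
    by (rule mean_measure_cells[OF pp, symmetric]) auto
  also have "\<dots> \<le> mean_measure M \<Phi> (cell (real n) (0, 0))"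
  proof (rule mean_measure_mono[OF pp _ cell_borel], rule UN_least)
    fix z assume "z \<in> ?A"
    then obtain i where i: "i < n" "z = (int i, 0)" by auto
    then have "real i + 1 \<le> real n" by linarith
    moreover have "1 \<le> real n" using n by simp
    ultimately show "cell 1 z \<subseteq> cell (real n) (0, 0)"
      using i(2) unfolding cell_def by auto
  qed
  finally show ?thesis .
qed

text \<open>All cells are empty exactly when their union is, and the mean of the union is
  \<open>card A\<close> times that of one cell. The exponential turns this additivity into a
  power.\<close>

lemma prob_empty_cells_le:
  assumes pp: "point_process M \<Phi>" and st: "stationary M \<Phi>" and nu: "nu_weakly_sub_poisson M \<Phi>"
    and s: "s > 0" and A: "finite A"
  shows "measure M {\<omega> \<in> space M. \<forall>z\<in>A. emeasure (\<Phi> \<omega>) (cell s z) = 0}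
    \<le> exp (- enn2real (mean_measure M \<Phi> (cell s (0, 0)))) ^ card A"
proof -
  define m where "m = enn2real (mean_measure M \<Phi> (cell s (0, 0)))"
  have "mean_measure M \<Phi> (cell s (0, 0)) < \<infinity>"
    using pp cell_borel bounded_cell unfolding point_process_def by blast
  then have m: "mean_measure M \<Phi> (cell s z) = ennreal m" "0 \<le> m" for z
    using mean_measure_cell[OF pp st] by (auto simp: m_def)
  have U: "(\<Union>z\<in>A. cell s z) \<in> sets borel"
    using A cell_borel by (intro sets.finite_UN) auto
  have "{\<omega> \<in> space M. \<forall>z\<in>A. emeasure (\<Phi> \<omega>) (cell s z) = 0}
      = {\<omega> \<in> space M. emeasure (\<Phi> \<omega>) (\<Union>z\<in>A. cell s z) = 0}"
  proof -
    have "(\<forall>z\<in>A. emeasure (\<Phi> \<omega>) (cell s z) = 0) \<longleftrightarrow> emeasure (\<Phi> \<omega>) (\<Union>z\<in>A. cell s z) = 0"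
      if "\<omega> \<in> space M" for \<omega>
    proof -
      have sets: "sets (\<Phi> \<omega>) = sets borel"
        by (rule configuration_sets[OF point_process_configuration[OF pp that]])
      have "emeasure (\<Phi> \<omega>) (\<Union>z\<in>A. cell s z) = (\<Sum>z\<in>A. emeasure (\<Phi> \<omega>) (cell s z))"
        using A cell_borel cell_disjoint[OF s]
        by (intro sum_emeasure[symmetric]) (auto simp: sets disjoint_family_on_def)
      then show ?thesis using A by simp
    qed
    then show ?thesis by blast
  qed
  also have "measure M \<dots> \<le> exp_neg (mean_measure M \<Phi> (\<Union>z\<in>A. cell s z))"
    using nu U unfolding nu_weakly_sub_poisson_def by blast
  also have "mean_measure M \<Phi> (\<Union>z\<in>A. cell s z) = ennreal (real (card A) * m)"
    using m by (simp add: mean_measure_cells[OF pp s A] ennreal_mult ennreal_of_nat_eq_real_of_nat)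
  also have "exp_neg \<dots> = exp (- m) ^ card A"
    using m(2) by (simp add: exp_neg_def exp_of_nat_mult[symmetric])
  finally show ?thesis by (simp only: m_def)
qed

lemma ex_scale_empty_cells:
  assumes pp: "point_process M \<Phi>" and st: "stationary M \<Phi>" and nu: "nu_weakly_sub_poisson M \<Phi>"
    and pos: "mean_measure M \<Phi> UNIV > 0" and \<epsilon>: "\<epsilon> > 0"
  shows "\<exists>s>0. \<forall>A. finite A \<longrightarrow>
    measure M {\<omega> \<in> space M. \<forall>z\<in>A. emeasure (\<Phi> \<omega>) (cell s z) = 0} \<le> \<epsilon> ^ card A"
proof -
  let ?m = "\<lambda>s. mean_measure M \<Phi> (cell s (0, 0))"
  have fin: "?m s < \<infinity>" for s
    using pp cell_borel bounded_cell unfolding point_process_def by blast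
  have m1: "0 < enn2real (?m 1)"
    using mean_measure_unit_cell_pos[OF pp st pos] fin[of 1] by (simp add: enn2real_positive_iff)
  obtain n where n: "- ln \<epsilon> < real n * enn2real (?m 1)" using reals_Archimedean3[OF m1] by blast
  \<comment> \<open>The successor guarantees a positive side length: \<open>n\<close> may be 0 when
    \<epsilon> exceeds 1.\<close>
  define k where "k = Suc n"
  have "- ln \<epsilon> < real k * enn2real (?m 1)"
    using n m1 by (simp add: k_def algebra_simps)
  also have "\<dots> = enn2real (of_nat k * ?m 1)"
    by (simp add: enn2real_mult)
  also have "\<dots> \<le> enn2real (?m (real k))"
    using mean_measure_cell_linear[OF pp st, of k] fin[of "real k"]
    by (intro enn2real_mono) (auto simp: k_def)
  finally have "exp (- enn2real (?m (real k))) \<le> \<epsilon>"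
    using \<epsilon> by (metis exp_ln exp_le_cancel_iff less_imp_le minus_less_iff neg_le_iff_le minus_le_iff)
  then have "exp (- enn2real (?m (real k))) ^ card A \<le> \<epsilon> ^ card A" for A :: "(int \<times> int) set"
    by (intro power_mono) auto
  moreover have k0: "real k > 0" by (simp add: k_def)
  ultimately have "\<forall>A. finite A \<longrightarrow>
      measure M {\<omega> \<in> space M. \<forall>z\<in>A. emeasure (\<Phi> \<omega>) (cell (real k) z) = 0} \<le> \<epsilon> ^ card A"
    using prob_empty_cells_le[OF pp st nu k0] order_trans by blast
  then show ?thesis using k0 by blast
qed

section \<open>Upper tails of additive functionals\<close>

text \<open>The moment generating function of a Poisson variable of mean r is exp (r (e^b - 1)), and
  e^b - 1 <= b + b^2 <= 2b on the unit interval. A bound linear in b is wanted, so that the total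
  weight controls the moment of a weighted sum.\<close>

lemma poisson_exp_moment_le:
  assumes pp: "poisson_process M' \<Phi> \<mu>" and \<mu>: "\<mu> > 0" and B: "B \<in> sets borel" "bounded B"
    and b: "0 \<le> b" "b \<le> 1"
  shows "(\<integral>\<^sup>+\<omega>. ennreal (exp (b * measure (\<Phi> \<omega>) B)) \<partial>M') \<le> ennreal (exp (2 * b * \<mu> * measure lborel B))"
proof -
  define r where "r = \<mu> * measure lborel B"
  have r: "0 \<le> r" using \<mu> by (simp add: r_def)
  have point: "point_process M' \<Phi>" using pp by (simp add: poisson_process_def)
  then interpret prob_space M' by (simp add: point_process_def)
  note meas = point_process_measurable[OF point B(1)]
  define E where "E n = {\<omega> \<in> space M'. emeasure (\<Phi> \<omega>) B = of_nat n}" for n :: nat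
  have E: "E n \<in> sets M'" for n
    unfolding E_def using measurable_sets[OF meas, of "{of_nat n}"] by (simp add: vimage_def Int_def conj_commute)
  have PE: "prob (E n) = exp (- r) * r ^ n / fact n" for n
    using pp B unfolding poisson_process_def E_def r_def by blast
  have "(\<integral>\<^sup>+\<omega>. ennreal (exp (b * measure (\<Phi> \<omega>) B)) \<partial>M')
      \<le> (\<integral>\<^sup>+\<omega>. (\<Sum>n. ennreal (exp (b * real n)) * indicator (E n) \<omega>) \<partial>M')"
  proof (rule nn_integral_mono)
    fix \<omega> assume \<omega>: "\<omega> \<in> space M'"
    obtain n where n: "emeasure (\<Phi> \<omega>) B = of_nat n"
      using configuration_Nats[OF point_process_configuration[OF point \<omega>] B] by (auto elim: Nats_cases)
    then have "measure (\<Phi> \<omega>) B = real n" by (simp add: measure_def)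
    then have "ennreal (exp (b * measure (\<Phi> \<omega>) B))
        = (\<Sum>n\<in>{n}. ennreal (exp (b * real n)) * indicator (E n) \<omega>)"
      using n \<omega> by (simp add: E_def)
    also have "\<dots> \<le> (\<Sum>n. ennreal (exp (b * real n)) * indicator (E n) \<omega>)"
      by (intro sum_le_suminf) auto
    finally show "ennreal (exp (b * measure (\<Phi> \<omega>) B))
        \<le> (\<Sum>n. ennreal (exp (b * real n)) * indicator (E n) \<omega>)" .
  qed
  also have "\<dots> = (\<Sum>n. ennreal (exp (b * real n)) * emeasure M' (E n))"
    using E by (simp add: nn_integral_suminf nn_integral_cmult_indicator)
  also have "\<dots> = (\<Sum>n. ennreal (exp (- r) * ((r * exp b) ^ n / fact n)))"
  proof (rule suminf_cong)
    fix n
    have "exp (b * real n) * prob (E n) = exp (- r) * ((r * exp b) ^ n / fact n)"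
      by (simp add: PE power_mult_distrib exp_of_nat2_mult)
    then show "ennreal (exp (b * real n)) * emeasure M' (E n)
        = ennreal (exp (- r) * ((r * exp b) ^ n / fact n))"
      by (simp add: emeasure_eq_measure ennreal_mult[symmetric])
  qed
  also have "\<dots> = ennreal (exp (- r) * exp (r * exp b))"
  proof (rule suminf_ennreal_eq)
    show "(\<lambda>n. exp (- r) * ((r * exp b) ^ n / fact n)) sums (exp (- r) * exp (r * exp b))"
      using exp_converges[of "r * exp b"] by (intro sums_mult) (simp add: field_simps)
  qed (use r in simp)
  also have "\<dots> \<le> ennreal (exp (2 * b * r))"
  proof (rule ennreal_leI)
    have "exp b \<le> 1 + b + b\<^sup>2" by (rule exp_bound[OF b])
    also have "b\<^sup>2 \<le> b" using b by (simp add: power2_eq_square mult_left_le)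
    finally have "r * exp b \<le> r * (1 + 2 * b)" using r by (intro mult_left_mono) auto
    then show "exp (- r) * exp (r * exp b) \<le> exp (2 * b * r)"
      by (simp add: exp_add[symmetric] algebra_simps)
  qed
  finally show ?thesis by (simp add: r_def mult.assoc)
qed

text \<open>The only use of independence of counts, and it concerns the comparison process
  alone.\<close>

lemma poisson_exp_moment_sum_le:
  fixes C :: "nat \<Rightarrow> 'b::euclidean_space set"
  assumes pp: "poisson_process M' \<Phi> \<mu>" and \<mu>: "\<mu> > 0"
    and C: "\<And>i. C i \<in> sets borel" "\<And>i. bounded (C i)" "disjoint_family C"
    and b: "\<And>i. 0 \<le> b i" "\<And>i. b i \<le> 1"
  shows "(\<integral>\<^sup>+\<omega>. ennreal (exp (\<Sum>i<k. b i * measure (\<Phi> \<omega>) (C i))) \<partial>M')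
    \<le> ennreal (exp (\<Sum>i<k. 2 * b i * \<mu> * measure lborel (C i)))"
proof -
  have point: "point_process M' \<Phi>" using pp by (simp add: poisson_process_def)
  then interpret prob_space M' by (simp add: point_process_def)
  have "disjoint_family_on C {..<k}" using C(3) by (auto simp: disjoint_family_on_def)
  then have ind: "indep_vars (\<lambda>_. borel) (\<lambda>i \<omega>. emeasure (\<Phi> \<omega>) (C i)) {..<k}"
  proof -
    have "\<forall>k (B :: nat \<Rightarrow> 'b set).
        (\<forall>i<k. B i \<in> sets borel \<and> bounded (B i)) \<and> disjoint_family_on B {..<k} \<longrightarrow>
        indep_vars (\<lambda>_. borel) (\<lambda>i \<omega>. emeasure (\<Phi> \<omega>) (B i)) {..<k}"
      using pp unfolding poisson_process_def by (elim conjE)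
    from this[rule_format, where k=k and B=C] show ?thesis
      using C(1,2) \<open>disjoint_family_on C {..<k}\<close> by simp
  qed
  have "indep_vars (\<lambda>_. borel) (\<lambda>i \<omega>. ennreal (exp (b i * enn2real (emeasure (\<Phi> \<omega>) (C i))))) {..<k}"
    by (rule indep_vars_compose2[OF ind]) measurable
  then have "(\<integral>\<^sup>+\<omega>. (\<Prod>i<k. ennreal (exp (b i * measure (\<Phi> \<omega>) (C i)))) \<partial>M')
      = (\<Prod>i<k. \<integral>\<^sup>+\<omega>. ennreal (exp (b i * measure (\<Phi> \<omega>) (C i))) \<partial>M')"
    unfolding measure_def by (intro indep_vars_nn_integral) auto
  also have "\<dots> \<le> (\<Prod>i<k. ennreal (exp (2 * b i * \<mu> * measure lborel (C i))))"
    by (intro prod_mono_ennreal poisson_exp_moment_le[OF pp \<mu> C(1,2) b])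
  also have "\<dots> = ennreal (exp (\<Sum>i<k. 2 * b i * \<mu> * measure lborel (C i)))"
    by (simp add: exp_sum prod_ennreal)
  finally show ?thesis by (simp add: exp_sum prod_ennreal)
qed

text \<open>The positive part of 1 + U - a for a weighted count U. The exponential of U is not
  compared directly: the order applies only when both expectations are finite, and
  \<open>\<Phi>I\<close> is not known to have exponential moments. The positive part grows linearly,
  so finite mean counts make it integrable.\<close>

definition hinge :: "nat \<Rightarrow> (nat \<Rightarrow> real) \<Rightarrow> real \<Rightarrow> (nat \<Rightarrow> real) \<Rightarrow> real" where
  "hinge k b a x = max 0 (1 - a + (\<Sum>i<k. b i * x i))"

text \<open>A nonnegative linear form maps the four points to reals in the same order and with the
  same balance of sums, which reduces the claim to convexity and monotonicity of the positive part
  on the line.\<close>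

lemma idcx_hinge:
  assumes b: "\<And>i. 0 \<le> b i"
  shows "idcx k (hinge k b a)"
  unfolding idcx_def dcx_def
proof (intro conjI ballI impI)
  have "hinge k b a \<in> borel_measurable (\<Pi>\<^sub>M i\<in>{..<k}. lborel)"
    unfolding hinge_def by measurable
  then show "hinge k b a \<in> borel_measurable (completion (\<Pi>\<^sub>M i\<in>{..<k}. lborel))"
    by (rule measurable_completion)
next
  fix x y p q :: "nat \<Rightarrow> real"
  assume h: "\<forall>i<k. p i \<le> x i \<and> x i \<le> q i \<and> p i \<le> y i \<and> y i \<le> q i \<and> x i + y i = p i + q i"
  let ?s = "\<lambda>x. \<Sum>i<k. b i * x i"
  have mono: "?s u \<le> ?s v" if "\<forall>i<k. u i \<le> v i" for u v
    using that b by (intro sum_mono mult_left_mono) auto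
  have "?s p \<le> ?s x" "?s x \<le> ?s q" "?s p \<le> ?s y" "?s y \<le> ?s q"
    using h by (auto intro!: mono)
  moreover have "?s x + ?s y = ?s p + ?s q"
    using h by (simp add: sum.distrib[symmetric] distrib_left[symmetric])
  ultimately show "hinge k b a x + hinge k b a y \<le> hinge k b a p + hinge k b a q"
    unfolding hinge_def by linarith
next
  fix x y :: "nat \<Rightarrow> real" assume "\<forall>i<k. x i \<le> y i"
  then have "(\<Sum>i<k. b i * x i) \<le> (\<Sum>i<k. b i * y i)"
    using b by (intro sum_mono mult_left_mono) auto
  then show "hinge k b a x \<le> hinge k b a y"
    unfolding hinge_def by linarith
qed

lemma point_process_integrable:
  assumes pp: "point_process M \<Phi>" and B: "B \<in> sets borel" "bounded B"
  shows "integrable M (\<lambda>\<omega>. measure (\<Phi> \<omega>) B)"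
proof (rule integrableI_bounded)
  show "(\<lambda>\<omega>. measure (\<Phi> \<omega>) B) \<in> borel_measurable M"
    unfolding measure_def using point_process_measurable[OF pp B(1)] by measurable
  have "(\<integral>\<^sup>+\<omega>. ennreal (norm (measure (\<Phi> \<omega>) B)) \<partial>M) \<le> mean_measure M \<Phi> B"
    unfolding mean_measure_def by (intro nn_integral_mono) (simp add: measure_def ennreal_enn2real_if)
  also have "\<dots> < \<infinity>" using pp B unfolding point_process_def by blast
  finally show "(\<integral>\<^sup>+\<omega>. ennreal (norm (measure (\<Phi> \<omega>) B)) \<partial>M) < \<infinity>" .
qed

lemma integrable_hinge:
  assumes pp: "point_process M \<Phi>" and C: "\<And>i. C i \<in> sets borel" "\<And>i. bounded (C i)"
  shows "integrable M (\<lambda>\<omega>. hinge k b a (\<lambda>i\<in>{..<k}. measure (\<Phi> \<omega>) (C i)))"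
proof -
  interpret prob_space M using pp by (simp add: point_process_def)
  have "integrable M (\<lambda>\<omega>. max 0 (1 - a + (\<Sum>i<k. b i * measure (\<Phi> \<omega>) (C i))))"
    by (intro Bochner_Integration.integrable_max integrable_const Bochner_Integration.integrable_add
        Bochner_Integration.integrable_sum integrable_mult_right point_process_integrable[OF pp] C)
  then show ?thesis by (simp add: hinge_def)
qed

text \<open>The indicator of \<open>U > a\<close> lies below the \<open>idcx\<close> function \<open>max 0 (1 + U - a)\<close>, which in turn lies
  below \<open>exp (U - a)\<close>.\<close>

lemma idcx_le_poisson_tail:
  fixes C :: "nat \<Rightarrow> 'b::euclidean_space set"
  assumes pp: "point_process M \<Phi>" and poi: "poisson_process M' \<Phi>' \<mu>" and \<mu>: "\<mu> > 0"
    and le: "idcx_le M \<Phi> M' \<Phi>'" and k: "k \<ge> 1"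
    and C: "\<And>i. C i \<in> sets borel" "\<And>i. bounded (C i)" "disjoint_family C"
    and b: "\<And>i. 0 \<le> b i" "\<And>i. b i \<le> 1"
  shows "measure M {\<omega> \<in> space M. (\<Sum>i<k. b i * measure (\<Phi> \<omega>) (C i)) > a}
    \<le> exp (- a + (\<Sum>i<k. 2 * b i * \<mu> * measure lborel (C i)))"
proof -
  have pp': "point_process M' \<Phi>'" using poi by (simp add: poisson_process_def)
  interpret prob_space M using pp by (simp add: point_process_def)
  let ?U = "\<lambda>\<omega>. \<Sum>i<k. b i * measure (\<Phi> \<omega>) (C i)"
  let ?U' = "\<lambda>\<omega>. \<Sum>i<k. b i * measure (\<Phi>' \<omega>) (C i)"
  let ?f = "\<lambda>\<omega>. hinge k b a (\<lambda>i\<in>{..<k}. measure (\<Phi> \<omega>) (C i))"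
  let ?f' = "\<lambda>\<omega>. hinge k b a (\<lambda>i\<in>{..<k}. measure (\<Phi>' \<omega>) (C i))"
  note int = integrable_hinge[OF pp C(1,2), of k b a] integrable_hinge[OF pp' C(1,2), of k b a]
  have U: "?U \<in> borel_measurable M"
    using point_process_integrable[OF pp C(1,2)] by (intro borel_measurable_sum borel_measurable_times) auto
  have "prob {\<omega> \<in> space M. ?U \<omega> > a} = integral\<^sup>L M (indicator {\<omega> \<in> space M. ?U \<omega> > a})"
    using U by simp
  also have "\<dots> \<le> integral\<^sup>L M ?f"
  proof (rule integral_mono)
    show "integrable M (indicator {\<omega> \<in> space M. ?U \<omega> > a} :: _ \<Rightarrow> real)"
      using U by (intro integrable_real_indicator) (auto simp: emeasure_eq_measure)
    show "indicator {\<omega> \<in> space M. ?U \<omega> > a} \<omega> \<le> ?f \<omega>" for \<omega>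
      by (auto simp: hinge_def indicator_def)
  qed (rule int(1))
  also have "\<dots> \<le> integral\<^sup>L M' ?f'"
  proof -
    have "(\<forall>i<k. C i \<in> sets borel \<and> bounded (C i)) \<and> idcx k (hinge k b a) \<and> integrable M ?f \<and> integrable M' ?f'"
      using C(1,2) idcx_hinge[of b k a, OF b(1)] int by simp
    from le[unfolded idcx_le_def, rule_format, OF k this] show ?thesis .
  qed
  also have "\<dots> \<le> exp (- a + (\<Sum>i<k. 2 * b i * \<mu> * measure lborel (C i)))"
  proof -
    have "ennreal (integral\<^sup>L M' ?f') = (\<integral>\<^sup>+\<omega>. ennreal (?f' \<omega>) \<partial>M')"
      by (rule nn_integral_eq_integral[symmetric, OF int(2)]) (simp add: hinge_def)
    also have "\<dots> \<le> (\<integral>\<^sup>+\<omega>. ennreal (exp (- a)) * ennreal (exp (?U' \<omega>)) \<partial>M')"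
    proof (rule nn_integral_mono)
      fix \<omega>
      have "?f' \<omega> \<le> exp (?U' \<omega> - a)"
      proof -
        have "?f' \<omega> = max 0 (1 + (?U' \<omega> - a))" by (simp add: hinge_def)
        then show ?thesis using exp_ge_add_one_self[of "?U' \<omega> - a"] by simp
      qed
      also have "\<dots> = exp (- a) * exp (?U' \<omega>)" by (simp add: exp_add[symmetric])
      finally have "ennreal (?f' \<omega>) \<le> ennreal (exp (- a) * exp (?U' \<omega>))" by (rule ennreal_leI)
      also have "\<dots> = ennreal (exp (- a)) * ennreal (exp (?U' \<omega>))" by (simp add: ennreal_mult)
      finally show "ennreal (?f' \<omega>) \<le> ennreal (exp (- a)) * ennreal (exp (?U' \<omega>))" .
    qed
    also have "\<dots> = ennreal (exp (- a)) * (\<integral>\<^sup>+\<omega>. ennreal (exp (?U' \<omega>)) \<partial>M')"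
    proof (rule nn_integral_cmult)
      have "?U' \<in> borel_measurable M'"
        using point_process_integrable[OF pp' C(1,2)] by (intro borel_measurable_sum borel_measurable_times) auto
      then show "(\<lambda>\<omega>. ennreal (exp (?U' \<omega>))) \<in> borel_measurable M'" by measurable
    qed
    also have "\<dots> \<le> ennreal (exp (- a)) * ennreal (exp (\<Sum>i<k. 2 * b i * \<mu> * measure lborel (C i)))"
      by (intro mult_left_mono poisson_exp_moment_sum_le[OF poi \<mu> C b]) simp
    also have "\<dots> = ennreal (exp (- a + (\<Sum>i<k. 2 * b i * \<mu> * measure lborel (C i))))"
      unfolding exp_add by (rule ennreal_mult[symmetric]) auto
    finally show ?thesis by (simp add: ennreal_le_iff)
  qed
  finally show ?thesis .
qed

text \<open>The order sees finitely many sets at a time, so the tail bound is applied to partial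
  sums. A series exceeds \<open>a\<close> strictly only if some partial sum does, and the events
  \<open>D k\<close> increase, so their uniform bound passes to the union.\<close>

lemma idcx_le_poisson_series_tail:
  fixes C :: "nat \<Rightarrow> 'b::euclidean_space set"
  assumes pp: "point_process M \<Phi>" and poi: "poisson_process M' \<Phi>' \<mu>" and \<mu>: "\<mu> > 0"
    and le: "idcx_le M \<Phi> M' \<Phi>'"
    and C: "\<And>i. C i \<in> sets borel" "\<And>i. bounded (C i)" "disjoint_family C"
    and b: "\<And>i. 0 \<le> b i" "\<And>i. b i \<le> 1"
    and L: "\<And>k. (\<Sum>i<k. 2 * b i * \<mu> * measure lborel (C i)) \<le> L" and a: "a \<ge> 0"
  shows "measure M {\<omega> \<in> space M. (\<Sum>i. ennreal (b i) * emeasure (\<Phi> \<omega>) (C i)) > ennreal a} \<le> exp (- a + L)"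
proof -
  interpret prob_space M using pp by (simp add: point_process_def)
  define D where "D k = {\<omega> \<in> space M. (\<Sum>i<k. b i * measure (\<Phi> \<omega>) (C i)) > a}" for k
  have D: "D k \<in> events" for k
  proof -
    have "(\<lambda>\<omega>. \<Sum>i<k. b i * measure (\<Phi> \<omega>) (C i)) \<in> borel_measurable M"
      using point_process_integrable[OF pp C(1,2)] by (intro borel_measurable_sum borel_measurable_times) auto
    then show ?thesis unfolding D_def by measurable
  qed
  have inc: "incseq D"
  proof (rule incseq_SucI)
    fix k
    have "(\<Sum>i<k. b i * measure (\<Phi> \<omega>) (C i)) \<le> (\<Sum>i<Suc k. b i * measure (\<Phi> \<omega>) (C i))" for \<omega>
      using b by simp
    then show "D k \<subseteq> D (Suc k)" unfolding D_def by (blast intro: less_le_trans)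
  qed
  have "{\<omega> \<in> space M. (\<Sum>i. ennreal (b i) * emeasure (\<Phi> \<omega>) (C i)) > ennreal a} \<subseteq> (\<Union>k. D k)"
  proof
    fix \<omega> assume "\<omega> \<in> {\<omega> \<in> space M. (\<Sum>i. ennreal (b i) * emeasure (\<Phi> \<omega>) (C i)) > ennreal a}"
    then have \<omega>: "\<omega> \<in> space M" "ennreal a < (\<Sum>i. ennreal (b i) * emeasure (\<Phi> \<omega>) (C i))" by auto
    have em: "emeasure (\<Phi> \<omega>) (C i) = ennreal (measure (\<Phi> \<omega>) (C i))" for i
      using Nats_ennreal_lt_top[OF configuration_Nats[OF point_process_configuration[OF pp \<omega>(1)] C(1,2)]]
      by (simp add: measure_def)
    obtain k where "ennreal a < (\<Sum>i<k. ennreal (b i) * emeasure (\<Phi> \<omega>) (C i))"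
      using \<omega>(2) unfolding suminf_eq_SUP less_SUP_iff by blast
    also have "\<dots> = ennreal (\<Sum>i<k. b i * measure (\<Phi> \<omega>) (C i))"
      using b by (simp add: em ennreal_mult[symmetric])
    finally have "a < (\<Sum>i<k. b i * measure (\<Phi> \<omega>) (C i))"
      using a by (simp add: ennreal_less_iff)
    then show "\<omega> \<in> (\<Union>k. D k)" using \<omega>(1) by (auto simp: D_def)
  qed
  then have "prob {\<omega> \<in> space M. (\<Sum>i. ennreal (b i) * emeasure (\<Phi> \<omega>) (C i)) > ennreal a} \<le> prob (\<Union>k. D k)"
    using D by (intro finite_measure_mono) auto
  also have "\<dots> \<le> exp (- a + L)"
  proof (rule LIMSEQ_le_const2)
    show "(\<lambda>k. prob (D k)) \<longlonglongrightarrow> prob (\<Union>k. D k)"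
      using D inc by (intro finite_Lim_measure_incseq) auto
    \<comment> \<open>\<open>idcx_le\<close> starts at dimension 1; the limit does not see k =
      0.\<close>
    have "prob (D k) \<le> exp (- a + L)" if "k \<ge> 1" for k
    proof -
      have "prob (D k) \<le> exp (- a + (\<Sum>i<k. 2 * b i * \<mu> * measure lborel (C i)))"
        unfolding D_def by (rule idcx_le_poisson_tail[OF pp poi \<mu> le that C b])
      also have "\<dots> \<le> exp (- a + L)" using L by simp
      finally show ?thesis .
    qed
    then show "\<exists>N. \<forall>k\<ge>N. prob (D k) \<le> exp (- a + L)" by blast
  qed
  finally show ?thesis .
qed

text \<open>If n cells all have interference above K, their sum exceeds nK. Exchanging the sums over
  receiving and emitting cells gives S times a weighted count with weights \<open>b j\<close>, whose
  tail at nK / S is at most exp (n (2 \<mu> s^2 - K / S)).\<close>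

lemma prob_large_cell_interference_le:
  assumes l: "attenuation l" "\<forall>x\<ge>0. l x > 0" and s: "s > 0"
    and pp: "point_process M \<Phi>" and poi: "poisson_process M' \<Phi>' \<mu>" and \<mu>: "\<mu> > 0"
    and le: "idcx_le M \<Phi> M' \<Phi>'" and \<epsilon>: "\<epsilon> > 0"
  shows "\<exists>K\<ge>0. \<forall>A. finite A \<longrightarrow>
    measure M {\<omega> \<in> space M. \<forall>z\<in>A. cell_interference l s (\<Phi> \<omega>) z > ennreal K} \<le> \<epsilon> ^ card A"
proof -
  interpret prob_space M using pp by (simp add: point_process_def)
  obtain S where S: "S > 0"
    and S1: "\<And>z. (\<Sum>j. ennreal (cell_attenuation l s (cell_enum j - z))) \<le> ennreal S"
    and S2: "\<And>w A. finite A \<Longrightarrow> (\<Sum>z\<in>A. cell_attenuation l s (w - z)) \<le> S"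
    using total_cell_attenuation[OF l s] by blast
  note nn = cell_attenuation_nonneg[OF l(2) s]
  \<comment> \<open>Chosen so that 2 \<mu> s^2 - K / S <= ln \<epsilon>; the maximum with 0 covers
    large \<epsilon>.\<close>
  define K where "K = max 0 (S * (2 * \<mu> * s\<^sup>2 - ln \<epsilon>))"
  have K: "0 \<le> K" "S * (2 * \<mu> * s\<^sup>2 - ln \<epsilon>) \<le> K" by (simp_all add: K_def)
  show ?thesis
  proof (intro exI[of _ K] conjI allI impI)
    show "0 \<le> K" by (rule K)
    fix A :: "(int \<times> int) set" assume A: "finite A"
    let ?J = "\<lambda>\<omega> z. cell_interference l s (\<Phi> \<omega>) z"
    show "prob {\<omega> \<in> space M. \<forall>z\<in>A. ?J \<omega> z > ennreal K} \<le> \<epsilon> ^ card A"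
    \<comment> \<open>The strict inequality between sums below needs an element of \<open>A\<close>;
      for empty \<open>A\<close> the bound is 1.\<close>
    proof (cases "A = {}")
      case False
      define n where "n = real (card A)"
      \<comment> \<open>Division by \<open>S\<close> brings the weights below 1, the range of the
        exponential moment bound.\<close>
      define b where "b j = (\<Sum>z\<in>A. cell_attenuation l s (cell_enum j - z)) / S" for j
      define C where "C j = cell s (cell_enum j)" for j
      have b: "0 \<le> b j" "b j \<le> 1" for j
        using S S2[OF A] nn by (auto simp: b_def sum_nonneg)
      have "disjoint_family C"
        unfolding disjoint_family_on_def
      proof (intro ballI impI)
        fix i j :: nat assume "i \<noteq> j"
        then have "cell_enum i \<noteq> cell_enum j" using bij_cell_enum by (simp add: bij_def inj_eq)
        then show "C i \<inter> C j = {}" unfolding C_def using cell_disjoint[OF s] by blast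
      qed
      then have C: "C j \<in> sets borel" "bounded (C j)" "disjoint_family C" for j
        by (simp_all add: C_def cell_borel bounded_cell)
      have sum_b: "(\<Sum>j<k. b j) \<le> n" for k
      proof -
        have col: "(\<Sum>j<k. cell_attenuation l s (cell_enum j - z)) \<le> S" for z
        proof -
          have "ennreal (\<Sum>j<k. cell_attenuation l s (cell_enum j - z))
              = (\<Sum>j<k. ennreal (cell_attenuation l s (cell_enum j - z)))"
            using nn by simp
          also have "\<dots> \<le> (\<Sum>j. ennreal (cell_attenuation l s (cell_enum j - z)))"
            by (intro sum_le_suminf) auto
          also have "\<dots> \<le> ennreal S" by (rule S1)
          finally show ?thesis using S by (simp add: ennreal_le_iff)
        qed
        have "S * (\<Sum>j<k. b j) = (\<Sum>j<k. \<Sum>z\<in>A. cell_attenuation l s (cell_enum j - z))"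
        proof -
          have "S * b j = (\<Sum>z\<in>A. cell_attenuation l s (cell_enum j - z))" for j
            using S by (simp add: b_def)
          then show ?thesis by (simp only: sum_distrib_left)
        qed
        also have "\<dots> = (\<Sum>z\<in>A. \<Sum>j<k. cell_attenuation l s (cell_enum j - z))"
          by (rule sum.swap)
        also have "\<dots> \<le> (\<Sum>z\<in>A. S)" by (intro sum_mono col)
        finally show ?thesis using S by (simp add: n_def mult.commute)
      qed
      have L: "(\<Sum>j<k. 2 * b j * \<mu> * measure lborel (C j)) \<le> 2 * \<mu> * s\<^sup>2 * n" for k
      proof -
        have "(\<Sum>j<k. 2 * b j * \<mu> * measure lborel (C j)) \<le> (\<Sum>j<k. 2 * b j * \<mu> * s\<^sup>2)"
          unfolding C_def using b \<mu> by (intro sum_mono mult_left_mono measure_cell_le[OF s]) auto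
        also have "\<dots> = (\<Sum>j<k. 2 * \<mu> * s\<^sup>2 * b j)" by (simp add: mult_ac)
        also have "\<dots> = 2 * \<mu> * s\<^sup>2 * (\<Sum>j<k. b j)" by (rule sum_distrib_left[symmetric])
        also have "\<dots> \<le> 2 * \<mu> * s\<^sup>2 * n" using \<mu> by (intro mult_left_mono sum_b) auto
        finally show ?thesis .
      qed
      have "{\<omega> \<in> space M. \<forall>z\<in>A. ?J \<omega> z > ennreal K}
          \<subseteq> {\<omega> \<in> space M. (\<Sum>j. ennreal (b j) * emeasure (\<Phi> \<omega>) (C j)) > ennreal (n * K / S)}"
      proof (intro Collect_mono impI conjI)
        fix \<omega> assume h: "\<omega> \<in> space M \<and> (\<forall>z\<in>A. ?J \<omega> z > ennreal K)"
        then show "\<omega> \<in> space M" by blast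
        have Sb: "ennreal S * ennreal (b j) = (\<Sum>z\<in>A. ennreal (cell_attenuation l s (cell_enum j - z)))" for j
          using S b nn by (simp add: ennreal_mult[symmetric] b_def)
        have "ennreal S * ennreal (n * K / S) = ennreal (n * K)"
          using S K by (simp add: ennreal_mult[symmetric] n_def)
        also have "\<dots> = (\<Sum>z\<in>A. ennreal K)"
          using K by (simp add: n_def ennreal_mult ennreal_of_nat_eq_real_of_nat)
        also have "\<dots> < (\<Sum>z\<in>A. ?J \<omega> z)"
        proof -
          obtain z where z: "z \<in> A" using False by blast
          \<comment> \<open>Strictness is kept for one chosen term; cancelling the others in
            \<open>ennreal\<close> requires their sum to be finite.\<close>
          have fin: "(\<Sum>z\<in>A - {z}. ennreal K) \<noteq> \<infinity>" by (simp add: ennreal_mult_eq_top_iff)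
          have "(\<Sum>z\<in>A. ennreal K) = (\<Sum>z\<in>A - {z}. ennreal K) + ennreal K"
            by (subst sum.remove[OF A z]) (rule add.commute)
          also have "\<dots> < (\<Sum>z\<in>A - {z}. ennreal K) + ?J \<omega> z"
            unfolding ennreal_add_left_cancel_less using fin h z by blast
          also have "\<dots> \<le> (\<Sum>z\<in>A - {z}. ?J \<omega> z) + ?J \<omega> z"
            using h by (intro add_right_mono sum_mono less_imp_le) blast
          also have "\<dots> = (\<Sum>z\<in>A. ?J \<omega> z)"
            by (subst sum.remove[OF A z]) (rule add.commute)
          finally show ?thesis .
        qed
        also have "\<dots> = (\<Sum>j. \<Sum>z\<in>A. ennreal (cell_attenuation l s (cell_enum j - z)) * emeasure (\<Phi> \<omega>) (C j))"
          unfolding cell_interference_def C_def by (rule suminf_sum[symmetric]) auto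
        also have "\<dots> = (\<Sum>j. ennreal S * (ennreal (b j) * emeasure (\<Phi> \<omega>) (C j)))"
          by (intro suminf_cong) (simp only: sum_distrib_right[symmetric] Sb[symmetric] mult.assoc)
        also have "\<dots> = ennreal S * (\<Sum>j. ennreal (b j) * emeasure (\<Phi> \<omega>) (C j))"
          by (rule ennreal_suminf_cmult)
        finally show "ennreal (n * K / S) < (\<Sum>j. ennreal (b j) * emeasure (\<Phi> \<omega>) (C j))"
          by (meson leD leI mult_left_mono zero_le)
      qed
      then have "prob {\<omega> \<in> space M. \<forall>z\<in>A. ?J \<omega> z > ennreal K}
          \<le> prob {\<omega> \<in> space M. (\<Sum>j. ennreal (b j) * emeasure (\<Phi> \<omega>) (C j)) > ennreal (n * K / S)}"
      proof (rule finite_measure_mono)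
        have "(\<lambda>\<omega>. \<Sum>j. ennreal (b j) * emeasure (\<Phi> \<omega>) (C j)) \<in> borel_measurable M"
          using point_process_measurable[OF pp C(1)] by measurable
        then show "{\<omega> \<in> space M. (\<Sum>j. ennreal (b j) * emeasure (\<Phi> \<omega>) (C j)) > ennreal (n * K / S)} \<in> events"
          by measurable
      qed
      also have "\<dots> \<le> exp (- (n * K / S) + 2 * \<mu> * s\<^sup>2 * n)"
        using S K by (intro idcx_le_poisson_series_tail[OF pp poi \<mu> le C b L]) (simp add: n_def)
      also have "\<dots> \<le> exp (n * ln \<epsilon>)"
      proof -
        have "2 * \<mu> * s\<^sup>2 - ln \<epsilon> \<le> K / S" using K(2) S by (simp add: field_simps)
        then have "n * (2 * \<mu> * s\<^sup>2 - ln \<epsilon>) \<le> n * (K / S)" by (intro mult_left_mono) (auto simp: n_def)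
        then show ?thesis by (simp add: algebra_simps)
      qed
      also have "\<dots> = \<epsilon> ^ card A" using \<epsilon> by (simp add: n_def exp_of_nat_mult)
      finally show ?thesis .
    qed (simp add: prob_space)
  qed
qed

text \<open>Split by the set \<open>B\<close> of sites with cause \<open>F\<close>. One of
  \<open>B\<close> and \<open>A - B\<close> has at least half of the sites, so its bound alone
  yields \<delta>^n for n sites, and there are 2^n subsets. Nothing is assumed about the joint law
  of the two causes; the price is the square root taken of the individual bounds.\<close>

lemma (in prob_space) prob_all_two_causes_le:
  assumes ev: "\<And>z. {\<omega> \<in> space M. F z \<omega>} \<in> events" "\<And>z. {\<omega> \<in> space M. G z \<omega>} \<in> events"
    and F: "\<And>A. finite A \<Longrightarrow> prob {\<omega> \<in> space M. \<forall>z\<in>A. F z \<omega>} \<le> (\<delta>\<^sup>2) ^ card A"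
    and G: "\<And>A. finite A \<Longrightarrow> prob {\<omega> \<in> space M. \<forall>z\<in>A. G z \<omega>} \<le> (\<delta>\<^sup>2) ^ card A"
    and \<delta>: "0 \<le> \<delta>" "\<delta> \<le> 1" and A: "finite A"
  shows "prob {\<omega> \<in> space M. \<forall>z\<in>A. F z \<omega> \<or> G z \<omega>} \<le> (2 * \<delta>) ^ card A"
proof -
  let ?E = "\<lambda>B. {\<omega> \<in> space M. (\<forall>z\<in>B. F z \<omega>) \<and> (\<forall>z\<in>A - B. G z \<omega>)}"
  have fin: "finite B" if "B \<in> Pow A" for B using that A finite_subset by blast
  have evF: "{\<omega> \<in> space M. \<forall>z\<in>B. F z \<omega>} \<in> events" and evG: "{\<omega> \<in> space M. \<forall>z\<in>B. G z \<omega>} \<in> events"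
    if "finite B" for B
    using that by (intro sets.sets_Collect_finite_All ev; simp)+
  have E: "?E B \<in> events" if "B \<in> Pow A" for B
    using fin[OF that] A by (intro sets.sets_Collect_conj evF evG) auto
  have bound: "prob (?E B) \<le> \<delta> ^ card A" if B: "B \<in> Pow A" for B
  proof -
    have card: "card A = card B + card (A - B)"
      using B A by (metis PowD card_Diff_subset card_mono fin le_add_diff_inverse)
    have "prob (?E B) \<le> prob {\<omega> \<in> space M. \<forall>z\<in>B. F z \<omega>}"
      by (rule finite_measure_mono[OF _ evF[OF fin[OF B]]]) blast
    also have "\<dots> \<le> \<delta> ^ (2 * card B)"
      using F[OF fin[OF B]] by (simp add: power_mult)
    finally have 1: "prob (?E B) \<le> \<delta> ^ (2 * card B)" .
    have "prob (?E B) \<le> prob {\<omega> \<in> space M. \<forall>z\<in>A - B. G z \<omega>}"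
      using A by (intro finite_measure_mono evG) auto
    also have "\<dots> \<le> \<delta> ^ (2 * card (A - B))"
      using G[of "A - B"] A by (simp add: power_mult)
    finally have 2: "prob (?E B) \<le> \<delta> ^ (2 * card (A - B))" .
    consider "card A \<le> 2 * card B" | "card A \<le> 2 * card (A - B)" using card by linarith
    then show ?thesis
    proof cases
      case 1
      then show ?thesis using \<open>prob (?E B) \<le> \<delta> ^ (2 * card B)\<close> power_decreasing[OF 1 \<delta>] by linarith
    next
      case 2
      then show ?thesis
        using \<open>prob (?E B) \<le> \<delta> ^ (2 * card (A - B))\<close> power_decreasing[OF 2 \<delta>] by linarith
    qed
  qed
  have "{\<omega> \<in> space M. \<forall>z\<in>A. F z \<omega> \<or> G z \<omega>} \<subseteq> (\<Union>B\<in>Pow A. ?E B)"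
  proof
    fix \<omega> assume "\<omega> \<in> {\<omega> \<in> space M. \<forall>z\<in>A. F z \<omega> \<or> G z \<omega>}"
    then have "\<omega> \<in> ?E {z \<in> A. F z \<omega>}" by blast
    then show "\<omega> \<in> (\<Union>B\<in>Pow A. ?E B)"
      by (rule UN_I[where a="{z \<in> A. F z \<omega>}", rotated]) blast
  qed
  then have "prob {\<omega> \<in> space M. \<forall>z\<in>A. F z \<omega> \<or> G z \<omega>} \<le> prob (\<Union>B\<in>Pow A. ?E B)"
    using A E by (intro finite_measure_mono sets.finite_UN) auto
  also have "\<dots> \<le> (\<Sum>B\<in>Pow A. prob (?E B))"
    using A E by (intro finite_measure_subadditive_finite) auto
  also have "\<dots> \<le> (\<Sum>B\<in>Pow A. \<delta> ^ card A)" by (intro sum_mono bound)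
  also have "\<dots> = (2 * \<delta>) ^ card A" using A by (simp add: card_Pow power_mult_distrib)
  finally show ?thesis .
qed

text \<open>Positivity of the mean measure excludes the empty process, which is stationary and
  weakly sub-Poisson but cannot percolate. Both processes live on \<open>M\<close> with arbitrary
  dependence; the Poisson process has its own space since only its law enters the
  comparison.\<close>

theorem proposition5p9:
  fixes M :: "'w measure" and M' :: "'v measure"
    and \<Phi> \<Phi>I :: "'w \<Rightarrow> (real^2) measure" and \<Phi>\<mu> :: "'v \<Rightarrow> (real^2) measure"
    and l :: "real \<Rightarrow> real" and N T \<mu> :: real
  assumes "N > 0" and "T > 0"
    and "attenuation l" and "\<forall>x\<ge>0. l x > 0"
    and "point_process M \<Phi>" and "stationary M \<Phi>" and "nu_weakly_sub_poisson M \<Phi>"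
    and "mean_measure M \<Phi> UNIV > 0"
    and "point_process M \<Phi>I"
    and "\<mu> > 0" and "poisson_process M' \<Phi>\<mu> \<mu>" and "idcx_le M \<Phi>I M' \<Phi>\<mu>"
  shows "\<exists>P \<gamma>. P > 0 \<and> \<gamma> > 0 \<and> l 0 \<ge> T * N / P \<and>
    (AE \<omega> in M. percolates (points (\<Phi> \<omega>)) (SINR_edges P N T l (\<Phi> \<omega>) (\<Phi>I \<omega>) \<gamma>))"
proof -
  note l = assms(3,4)
  interpret prob_space M using assms(5) by (simp add: point_process_def)
  define \<delta> :: real where "\<delta> = 1 / 324"
  have "\<delta>\<^sup>2 > 0" by (simp add: \<delta>_def)
  obtain s where s: "s > 0" and empty: "\<And>A. finite A \<Longrightarrow>
      prob {\<omega> \<in> space M. \<forall>z\<in>A. emeasure (\<Phi> \<omega>) (cell s z) = 0} \<le> (\<delta>\<^sup>2) ^ card A"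
    using ex_scale_empty_cells[OF assms(5-8) \<open>\<delta>\<^sup>2 > 0\<close>] by blast
  obtain K where K: "K \<ge> 0" and noisy: "\<And>A. finite A \<Longrightarrow>
      prob {\<omega> \<in> space M. \<forall>z\<in>A. cell_interference l s (\<Phi>I \<omega>) z > ennreal K} \<le> (\<delta>\<^sup>2) ^ card A"
    using prob_large_cell_interference_le[OF l s assms(9,11,10,12) \<open>\<delta>\<^sup>2 > 0\<close>] by blast
  define B where "B \<omega> = {z. emeasure (\<Phi> \<omega>) (cell s z) = 0 \<or> cell_interference l s (\<Phi>I \<omega>) z > ennreal K}" for \<omega>
  have ev_empty: "{\<omega> \<in> space M. emeasure (\<Phi> \<omega>) (cell s z) = 0} \<in> events" for z
    using point_process_measurable[OF assms(5) cell_borel] by measurable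
  have ev_noisy: "{\<omega> \<in> space M. cell_interference l s (\<Phi>I \<omega>) z > ennreal K} \<in> events" for z
  proof -
    have "(\<lambda>\<omega>. cell_interference l s (\<Phi>I \<omega>) z) \<in> borel_measurable M"
      unfolding cell_interference_def
      using point_process_measurable[OF assms(9) cell_borel] by measurable
    then show ?thesis by measurable
  qed
  have "AE \<omega> in M. \<exists>u. u \<notin> B \<omega> \<and> infinite {v. (u, v) \<in> (lattice_edges (\<lambda>u. u \<notin> B \<omega>))\<^sup>*}"
  proof (rule AE_infinite_component)
    show "{\<omega> \<in> space M. z \<in> B \<omega>} \<in> events" for z
      unfolding B_def mem_Collect_eq by (intro sets.sets_Collect_disj ev_empty ev_noisy)
    show "prob {\<omega> \<in> space M. Z \<subseteq> B \<omega>} \<le> (2 * \<delta>) ^ card Z" if "finite Z" for Z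
    proof -
      have "{\<omega> \<in> space M. Z \<subseteq> B \<omega>} = {\<omega> \<in> space M. \<forall>z\<in>Z.
          emeasure (\<Phi> \<omega>) (cell s z) = 0 \<or> cell_interference l s (\<Phi>I \<omega>) z > ennreal K}"
        unfolding B_def by blast
      also have "prob \<dots> \<le> (2 * \<delta>) ^ card Z"
        by (rule prob_all_two_causes_le[OF ev_empty ev_noisy empty noisy _ _ that]) (simp_all add: \<delta>_def)
      finally show ?thesis .
    qed
  qed (simp_all add: \<delta>_def)
  moreover
  have l4: "0 < l (4 * s)" using l(2) s by simp
  \<comment> \<open>The factor 3 makes P * l (4 * s) = 3 * N * T strictly larger than 2 * N *
    T.\<close>
  define P where "P = 3 * N * T / l (4 * s)"
  \<comment> \<open>K + 1 in place of K avoids division by 0 and leaves \<gamma> * P * K = N * K /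
    (K + 1) <= N.\<close>
  define \<gamma> where "\<gamma> = N / (P * (K + 1))"
  have P: "0 < P" using assms(1,2) l4 by (simp add: P_def)
  have \<gamma>: "0 < \<gamma>" using assms(1) P K by (simp add: \<gamma>_def)
  have power: "2 * N * T < P * l (4 * s)" using assms(1,2) l4 by (simp add: P_def)
  have noise: "\<gamma> * P * K \<le> N"
  proof -
    have "\<gamma> * P * K = N * (K / (K + 1))" using P by (simp add: \<gamma>_def)
    also have "\<dots> \<le> N * 1" using assms(1) K by (intro mult_left_mono) auto
    finally show ?thesis by simp
  qed
  have threshold: "T * N / P \<le> l 0"
  proof -
    have "T * N / P = l (4 * s) / 3" using assms(1,2) l4 by (simp add: P_def)
    also have "\<dots> \<le> l (4 * s)" using l4 by simp
    also have "\<dots> \<le> l 0" using s by (intro attenuation_antimono[OF l]) auto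
    finally show ?thesis .
  qed
  ultimately have "AE \<omega> in M. percolates (points (\<Phi> \<omega>)) (SINR_edges P N T l (\<Phi> \<omega>) (\<Phi>I \<omega>) \<gamma>)"
  proof (elim AE_mp, intro AE_I2 impI)
    fix \<omega> assume \<omega>: "\<omega> \<in> space M"
      and "\<exists>u. u \<notin> B \<omega> \<and> infinite {v. (u, v) \<in> (lattice_edges (\<lambda>u. u \<notin> B \<omega>))\<^sup>*}"
    then obtain u where u: "u \<notin> B \<omega>" "infinite {v. (u, v) \<in> (lattice_edges (\<lambda>u. u \<notin> B \<omega>))\<^sup>*}"
      by blast
    have conf: "\<Phi> \<omega> \<in> configurations" "\<Phi>I \<omega> \<in> configurations"
      using point_process_configuration[OF assms(5) \<omega>] point_process_configuration[OF assms(9) \<omega>] .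
    show "percolates (points (\<Phi> \<omega>)) (SINR_edges P N T l (\<Phi> \<omega>) (\<Phi>I \<omega>) \<gamma>)"
    proof (rule percolates_of_infinite_component[OF s _ _ u])
      show "\<exists>x\<in>cell s z. x \<in> points (\<Phi> \<omega>)" if "z \<notin> B \<omega>" for z
        using that ex_point_of_nonzero_measure[OF conf(1) cell_borel bounded_cell] by (simp add: B_def)
    next
      fix z w X Y
      assume zw: "z \<notin> B \<omega>" "w \<notin> B \<omega>" "lattice_adj z w"
        and XY: "X \<in> cell s z" "Y \<in> cell s w" "X \<in> points (\<Phi> \<omega>)" "Y \<in> points (\<Phi> \<omega>)"
      have I: "cell_interference l s (\<Phi>I \<omega>) z \<le> ennreal K" "cell_interference l s (\<Phi>I \<omega>) w \<le> ennreal K"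
        using zw(1,2) by (simp_all add: B_def not_less)
      have "ennreal T < SINR P N l X Y (\<Phi>I \<omega>) \<gamma>"
        by (rule SINR_gt_threshold[OF l conf(2) s XY(1,2) zw(3) assms(1,2) P \<gamma> K I(2) noise power])
      moreover have "ennreal T < SINR P N l Y X (\<Phi>I \<omega>) \<gamma>"
        by (rule SINR_gt_threshold[OF l conf(2) s XY(2,1) lattice_adj_sym[OF zw(3)] assms(1,2) P \<gamma> K
              I(1) noise power])
      ultimately show "(X, Y) \<in> SINR_edges P N T l (\<Phi> \<omega>) (\<Phi>I \<omega>) \<gamma>"
        using XY(3,4) by (simp add: SINR_edges_def)
    qed
  qed
  then show ?thesis using P \<gamma> threshold by blast
qed

end
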